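(* Let $R$ be an integral domain, $g(x,y)\in R[x,y]$, and set $$S_g:=\bigl(xyz=g(x,y)\bigr)\subset\mathbb{A}^3_R .$$ Assume that $g$ has bidegree $(n,m)$ (degree $n$ in $x$ and degree $m$ in $y$) with $n,m\ge 3$, and that the coefficients of $x^n$, $y^m$ and $1$ in $g$ are units in $R$. Then there is an explicit, infinite order automorphism $\sigma_g$ of $S_g$, defined over $R$. Explicitly: put $a(x):=g(x,0)$, $b(y):=g(0,y)$, $c:=g(0,0)$, and write $g=a(x)+b(y)-c+xy\,h(x,y)$ with $h\in R[x,y]$, so that $z\mapsto z-h(x,y)$ identifies $S_g$ with $S_{a,b}:=\bigl(xyz=a(x)+b(y)-c\bigr)$. With $\bar a$, $\bar b$, $\sigma_x$, $\sigma_y$ as defined in the context, $\sigma_x$ and $\sigma_y$ are $R$-isomorphisms, and $\sigma_g$ is the composition $$S_{a,b}\stackrel{\sigma_y}{\longrightarrow}S_{\bar a,b}\stackrel{\sigma_x}{\longrightarrow}S_{\bar a,\bar b}\stackrel{\sigma_y}{\longrightarrow}S_{a,\bar b}\stackrel{\sigma_x}{\longrightarrow}S_{a,b}.$$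
   Context: For a polynomial $a(t)=a_nt^n+\cdots+a_0\in R[t]$ with $a_n,a_0$ units, define $a^*(t)$ by $a(t)=t\,a^*(t)+a_0$, and set $\bar a(t):=\frac{1}{a_0^{\,n-1}a_n}\,t^n a\bigl(\tfrac{a_0}{t}\bigr)$. Then $\bar a\in R[t]$ has degree $n$, unit leading coefficient, $\bar a(0)=a_0$, and $\bar{\bar a}=a$. For polynomials $a,b$ of degrees $\geq 3$ with unit leading coefficients and $a(0)=b(0)=c$ a unit, set $S_{a,b}:=\bigl(xyz=a(x)+b(y)-c\bigr)\subset\mathbb{A}^3_R$. The map $\sigma_y:S_{a,b}\to S_{\bar a,b}$ is $(x,y,z)\mapsto(\bar x,y,\bar z)$ with $\bar x=yz-a^*(x)$ (which equals $b(y)/x$ where $x\ne0$) and $\bar z=\bigl(\bar a^*(\bar x)+x\bigr)/y$, where $\bar a^*:=(\bar a)^*$; the assertion that $\sigma_y$ is an $R$-morphism includes that this quotient is a regular function on $S_{a,b}$. The map $\sigma_x:S_{a,b}\to S_{a,\bar b}$ is defined by interchanging the roles of $x,a$ and $y,b$: $(x,y,z)\mapsto(x,\bar y,\bar z)$ with $\bar y=xz-b^*(y)$ (equal to $a(x)/y$ where $y\neq 0$) and $\bar z=\bigl(\bar b^*(\bar y)+y\bigr)/x$. *)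

theory Defs
  imports "HOL-Computational_Algebra.Polynomial" "HOL-Algebra.QuotRing"
begin

text \<open>
  Polynomial rings in several variables are iterated: \<open>R[x,y]\<close> is \<open>'a poly poly\<close>, with outer
  variable \<open>y\<close>, and \<open>R[x,y,z]\<close> is \<open>'a poly poly poly\<close>, with outer variable \<open>z\<close>. So the
  coefficient of \<open>x^i y^j\<close> in \<open>g\<close> is \<open>coeff (coeff g j) i\<close>.
\<close>

type_synonym 'a poly3 = "'a poly poly poly"

definition C3 :: "'a::idom \<Rightarrow> 'a poly3"
  where "C3 r = [:[:[:r:]:]:]"

definition X3 :: "'a::idom poly3"
  where "X3 = [:[:[:0, 1:]:]:]"

definition Y3 :: "'a::idom poly3"
  where "Y3 = [:[:0, 1:]:]"

definition Z3 :: "'a::idom poly3"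
  where "Z3 = [:0, 1:]"

definition eval3 :: "'a::idom poly \<Rightarrow> 'a poly3 \<Rightarrow> 'a poly3"
  where "eval3 p P = poly (map_poly C3 p) P"

definition degree_x :: "'a::idom poly poly \<Rightarrow> nat"
  where "degree_x g = Max ((\<lambda>j. degree (coeff g j)) ` {..degree g})"


subsection \<open>The surfaces and their morphisms\<close>

definition ring_of_type :: "'a::comm_ring_1 ring"
  where "ring_of_type = \<lparr>carrier = UNIV, mult = (*), one = 1, zero = 0, add = (+)\<rparr>"

definition surface_ideal :: "'a::idom poly poly \<Rightarrow> 'a poly3 set"
  where "surface_ideal g = PIdl\<^bsub>ring_of_type\<^esub> (X3 * Y3 * Z3 - [:g:])"

text \<open>The ring of regular functions on \<open>S\<^sub>g\<close>.\<close>

definition coord_ring :: "'a::idom poly poly \<Rightarrow> 'a poly3 set ring"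
  where "coord_ring g = ring_of_type Quot surface_ideal g"

definition fn :: "'a::idom poly poly \<Rightarrow> 'a poly3 \<Rightarrow> 'a poly3 set"
  where "fn g P = surface_ideal g +>\<^bsub>ring_of_type\<^esub> P"

text \<open>
  A morphism \<open>S\<^sub>g \<rightarrow> S\<^sub>g\<^sub>'\<close> of affine \<open>R\<close>-schemes is represented by its pullback, an \<open>R\<close>-algebra
  homomorphism from \<open>coord_ring g'\<close> to \<open>coord_ring g\<close>. Pullbacks are taken to be \<open>undefined\<close>
  outside the carrier, so that equality of morphisms is equality of functions.
\<close>

type_synonym 'a morphism = "'a poly3 set \<Rightarrow> 'a poly3 set"

definition Mor :: "'a::idom poly poly \<Rightarrow> 'a poly poly \<Rightarrow> 'a morphism set"
  where "Mor g g' = {\<phi> \<in> ring_hom (coord_ring g') (coord_ring g).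
    \<phi> \<in> extensional (carrier (coord_ring g')) \<and> (\<forall>r. \<phi> (fn g' (C3 r)) = fn g (C3 r))}"

definition mor_id :: "'a::idom poly poly \<Rightarrow> 'a morphism"
  where "mor_id g = (\<lambda>f\<in>carrier (coord_ring g). f)"

text \<open>
  \<open>mor_comp g \<psi> \<phi>\<close> is \<open>\<psi>\<close> after \<open>\<phi>\<close>, where \<open>S\<^sub>g\<close> is the target of \<open>\<psi>\<close>; on pullbacks the order is
  reversed.
\<close>

definition mor_comp :: "'a::idom poly poly \<Rightarrow> 'a morphism \<Rightarrow> 'a morphism \<Rightarrow> 'a morphism"
  where "mor_comp g \<psi> \<phi> = compose (carrier (coord_ring g)) \<phi> \<psi>"

definition mutually_inverse ::
    "'a::idom poly poly \<Rightarrow> 'a poly poly \<Rightarrow> 'a morphism \<Rightarrow> 'a morphism \<Rightarrow> bool"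
  where "mutually_inverse g g' \<phi> \<psi> \<longleftrightarrow>
    mor_comp g \<psi> \<phi> = mor_id g \<and> mor_comp g' \<phi> \<psi> = mor_id g'"

definition Iso :: "'a::idom poly poly \<Rightarrow> 'a poly poly \<Rightarrow> 'a morphism set"
  where "Iso g g' = {\<phi> \<in> Mor g g'. \<exists>\<psi>\<in>Mor g' g. mutually_inverse g g' \<phi> \<psi>}"

definition mor_inv :: "'a::idom poly poly \<Rightarrow> 'a poly poly \<Rightarrow> 'a morphism \<Rightarrow> 'a morphism"
  where "mor_inv g g' \<phi> = (THE \<psi>. \<psi> \<in> Mor g' g \<and> mutually_inverse g g' \<phi> \<psi>)"

definition Aut :: "'a::idom poly poly \<Rightarrow> 'a morphism monoid"
  where "Aut g = \<lparr>carrier = Iso g g, mult = mor_comp g, one = mor_id g\<rparr>"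

definition infinite_order :: "('b, 'c) monoid_scheme \<Rightarrow> 'b \<Rightarrow> bool"
  where "infinite_order G \<sigma> \<longleftrightarrow> (\<forall>k::nat. k > 0 \<longrightarrow> \<sigma> [^]\<^bsub>G\<^esub> k \<noteq> \<one>\<^bsub>G\<^esub>)"

text \<open>The coordinates of a morphism into \<open>S\<^sub>g\<^sub>'\<close>, and the morphism with given coordinates.\<close>

definition coords ::
    "'a::idom poly poly \<Rightarrow> 'a morphism \<Rightarrow> 'a poly3 set \<times> 'a poly3 set \<times> 'a poly3 set"
  where "coords g' \<phi> = (\<phi> (fn g' X3), \<phi> (fn g' Y3), \<phi> (fn g' Z3))"

definition mor_of_coords :: "'a::idom poly poly \<Rightarrow> 'a poly poly
    \<Rightarrow> 'a poly3 set \<times> 'a poly3 set \<times> 'a poly3 set \<Rightarrow> 'a morphism"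
  where "mor_of_coords g g' w = (THE \<phi>. \<phi> \<in> Mor g g' \<and> coords g' \<phi> = w)"

text \<open>The quotient of the functions \<open>P\<close> and \<open>Q\<close> on \<open>S\<^sub>g\<close>, provided it is regular.\<close>

definition is_quotient ::
    "'a::idom poly poly \<Rightarrow> 'a poly3 \<Rightarrow> 'a poly3 \<Rightarrow> 'a poly3 set \<Rightarrow> bool"
  where "is_quotient g P Q w \<longleftrightarrow>
    w \<in> carrier (coord_ring g) \<and> fn g Q \<otimes>\<^bsub>coord_ring g\<^esub> w = fn g P"

definition quotient :: "'a::idom poly poly \<Rightarrow> 'a poly3 \<Rightarrow> 'a poly3 \<Rightarrow> 'a poly3 set"
  where "quotient g P Q = (THE w. is_quotient g P Q w)"


subsection \<open>The maps \<open>\<sigma>\<^sub>x\<close> and \<open>\<sigma>\<^sub>y\<close>\<close>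

definition unit_inv :: "'a::idom \<Rightarrow> 'a"
  where "unit_inv u = (THE v. u * v = 1)"

text \<open>\<open>star a\<close> is \<open>a\<^sup>*\<close>, characterised by \<open>a = pCons (coeff a 0) (star a)\<close>.\<close>

definition star :: "'a::idom poly \<Rightarrow> 'a poly"
  where "star a = poly_shift 1 a"

text \<open>The sum is \<open>t^n a(a\<^sub>0 / t)\<close>, multiplied out.\<close>

definition bar :: "'a::idom poly \<Rightarrow> 'a poly"
  where "bar a = (let n = degree a; a0 = coeff a 0 in
    smult (unit_inv (a0 ^ (n - 1) * coeff a n)) (\<Sum>i\<le>n. monom (coeff a i * a0 ^ i) (n - i)))"

definition admissible :: "'a::idom poly \<Rightarrow> 'a poly \<Rightarrow> bool"
  where "admissible a b \<longleftrightarrow> degree a \<ge> 3 \<and> degree b \<ge> 3 \<and> lead_coeff a dvd 1 \<and> lead_coeff b dvd 1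
    \<and> poly a 0 = poly b 0 \<and> poly a 0 dvd 1"

text \<open>\<open>a(x) + b(y) - c\<close>, where \<open>c = a(0) = b(0)\<close>, so that \<open>S\<^sub>a\<^sub>,\<^sub>b\<close> is the surface of \<open>S a b\<close>.\<close>

definition S :: "'a::idom poly \<Rightarrow> 'a poly \<Rightarrow> 'a poly poly"
  where "S a b = [:a:] + map_poly (\<lambda>r. [:r:]) b - [:[:poly a 0:]:]"

definition ybar_x :: "'a::idom poly \<Rightarrow> 'a poly3"
  where "ybar_x b = X3 * Z3 - eval3 (star b) Y3"

definition znum_x :: "'a::idom poly \<Rightarrow> 'a poly3"
  where "znum_x b = eval3 (star (bar b)) (ybar_x b) + Y3"

definition sigma_x_coords ::
    "'a::idom poly \<Rightarrow> 'a poly \<Rightarrow> 'a poly3 set \<times> 'a poly3 set \<times> 'a poly3 set"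
  where "sigma_x_coords a b =
    (fn (S a b) X3, fn (S a b) (ybar_x b), quotient (S a b) (znum_x b) X3)"

definition sigma_x :: "'a::idom poly \<Rightarrow> 'a poly \<Rightarrow> 'a morphism"
  where "sigma_x a b = mor_of_coords (S a b) (S a (bar b)) (sigma_x_coords a b)"

definition xbar_y :: "'a::idom poly \<Rightarrow> 'a poly3"
  where "xbar_y a = Y3 * Z3 - eval3 (star a) X3"

definition znum_y :: "'a::idom poly \<Rightarrow> 'a poly3"
  where "znum_y a = eval3 (star (bar a)) (xbar_y a) + X3"

definition sigma_y_coords ::
    "'a::idom poly \<Rightarrow> 'a poly \<Rightarrow> 'a poly3 set \<times> 'a poly3 set \<times> 'a poly3 set"
  where "sigma_y_coords a b =
    (fn (S a b) (xbar_y a), fn (S a b) Y3, quotient (S a b) (znum_y a) Y3)"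

definition sigma_y :: "'a::idom poly \<Rightarrow> 'a poly \<Rightarrow> 'a morphism"
  where "sigma_y a b = mor_of_coords (S a b) (S (bar a) b) (sigma_y_coords a b)"

definition sigma_ab :: "'a::idom poly \<Rightarrow> 'a poly \<Rightarrow> 'a morphism"
  where "sigma_ab a b =
    mor_comp (S a b) (sigma_x a (bar b))
      (mor_comp (S a (bar b)) (sigma_y (bar a) (bar b))
        (mor_comp (S (bar a) (bar b)) (sigma_x (bar a) b)
          (sigma_y a b)))"


subsection \<open>The automorphism of \<open>S\<^sub>g\<close>\<close>

text \<open>The parts \<open>g(x,0)\<close>, \<open>g(0,y)\<close> and \<open>h\<close> of \<open>g = a(x) + b(y) - c + x y h(x,y)\<close>.\<close>

definition x_part :: "'a::idom poly poly \<Rightarrow> 'a poly"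
  where "x_part g = poly g 0"

definition y_part :: "'a::idom poly poly \<Rightarrow> 'a poly"
  where "y_part g = map_poly (\<lambda>p. poly p 0) g"

definition xy_part :: "'a::idom poly poly \<Rightarrow> 'a poly poly"
  where "xy_part g = map_poly (poly_shift 1) (poly_shift 1 g)"

definition shear_coords ::
    "'a::idom poly poly \<Rightarrow> 'a poly3 set \<times> 'a poly3 set \<times> 'a poly3 set"
  where "shear_coords g = (fn g X3, fn g Y3, fn g (Z3 - [:xy_part g:]))"

definition shear :: "'a::idom poly poly \<Rightarrow> 'a morphism"
  where "shear g = mor_of_coords g (S (x_part g) (y_part g)) (shear_coords g)"

text \<open>\<open>sigma_ab\<close> transported to \<open>S\<^sub>g\<close> by the isomorphism \<open>shear g\<close>.\<close>

definition sigma :: "'a::idom poly poly \<Rightarrow> 'a morphism"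
  where "sigma g = (let Sab = S (x_part g) (y_part g) in
    mor_comp g (mor_inv g Sab (shear g))
      (mor_comp Sab (sigma_ab (x_part g) (y_part g)) (shear g)))"

end

theory Submission
  imports Defs "HOL-Computational_Algebra.Formal_Laurent_Series"
begin

text \<open>
  On \<open>S\<^sub>a\<^sub>,\<^sub>b\<close> one has \<open>x \<bar>x = b(y)\<close> for \<open>\<bar>x = y z - a\<^sup>*(x)\<close>, and modulo \<open>y\<close> this reads \<open>x \<bar>x = c\<close>. Since
  \<open>a(x) = 0\<close> modulo \<open>y\<close>, also \<open>\<bar>a(\<bar>x) = 0\<close>, so \<open>\<bar>a\<^sup>*(\<bar>x) + x\<close> is divisible by \<open>y\<close>, and \<open>\<sigma>\<^sub>y\<close> is a morphism. As
  \<open>\<bar>\<bar>a = a\<close>, its inverse is \<open>\<sigma>\<^sub>y\<close> for the pair \<open>\<bar>a, b\<close>.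

  Infinite order is detected on a single point over the Laurent series, with \<open>x = 1\<close> and \<open>y = 1/t\<close>.
  The successive new coordinates satisfy \<open>u\<^sub>k\<^sub>-\<^sub>1 u\<^sub>k\<^sub>+\<^sub>1 = p\<^sub>k(u\<^sub>k)\<close> with \<open>deg p\<^sub>k \<ge> 3\<close>, so the pole orders
  \<open>d\<^sub>k\<close> obey \<open>d\<^sub>k\<^sub>+\<^sub>1 \<ge> 3 d\<^sub>k - d\<^sub>k\<^sub>-\<^sub>1\<close> and grow strictly: no positive power fixes the point.
\<close>

subsection \<open>Substitution homomorphisms\<close>

text \<open>Homomorphisms of whole types keep polynomial computations within the ordinary ring
  operations; \<open>ring_hom\<close> enters only with the coordinate rings.\<close>

locale type_hom =
  fixes k :: "'a::idom \<Rightarrow> 'l::idom"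
  assumes hom_add: "k (a + b) = k a + k b"
    and hom_mult: "k (a * b) = k a * k b"
    and hom_one: "k 1 = 1"
begin

lemma hom_zero: "k 0 = 0"
  using hom_add[of 0 0] by (metis add.right_neutral add_left_cancel)

lemma hom_minus: "k (- a) = - k a"
  using hom_add[of a "- a"] by (simp add: hom_zero eq_neg_iff_add_eq_0 add.commute)

lemma hom_diff: "k (a - b) = k a - k b"
  using hom_add[of a "- b"] by (simp add: hom_minus)

lemma hom_dvd: "a dvd b \<Longrightarrow> k a dvd k b"
  by (auto simp: dvd_def hom_mult)

lemmas hom_simps = hom_add hom_mult hom_one hom_zero hom_minus hom_diff

lemma map_poly_add: "map_poly k (p + q) = map_poly k p + map_poly k q"
  by (rule poly_eqI) (simp add: coeff_map_poly hom_simps)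

lemma map_poly_pCons_hom: "map_poly k (pCons c p) = pCons (k c) (map_poly k p)"
  by (rule map_poly_pCons) (rule hom_zero)

lemma map_poly_smult_hom: "map_poly k (smult c p) = smult (k c) (map_poly k p)"
  by (rule map_poly_smult) (simp_all add: hom_simps)

lemma map_poly_mult: "map_poly k (p * q) = map_poly k p * map_poly k q"
  by (induction p) (simp_all add: map_poly_pCons_hom map_poly_add map_poly_smult_hom hom_zero)

text \<open>Evaluation yields another instance of the locale, so three nested uses give
  homomorphisms out of R[x,y,z].\<close>

lemma type_hom_poly: "type_hom (\<lambda>p. poly (map_poly k p) x)"
  by unfold_locales (simp_all add: map_poly_add map_poly_mult hom_one map_poly_1)

end

text \<open>Evaluation at a point of an algebra with structure map \<open>k\<close>: with
  \<open>k = C3\<close> it substitutes polynomials, with \<open>k = fls_const\<close> it gives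
  Laurent series points.\<close>

definition subst3 ::
    "('a::idom \<Rightarrow> 'l::idom) \<Rightarrow> 'l \<Rightarrow> 'l \<Rightarrow> 'l \<Rightarrow> 'a poly3 \<Rightarrow> 'l"
  where "subst3 k x y z P =
    poly (map_poly (\<lambda>q. poly (map_poly (\<lambda>p. poly (map_poly k p) x) q) y) P) z"

context type_hom
begin

lemma type_hom_subst3: "type_hom (subst3 k x y z)"
  unfolding subst3_def
  by (intro type_hom.type_hom_poly type_hom_axioms)

lemma subst3_simps [simp]:
  "subst3 k x y z (C3 r) = k r" "subst3 k x y z X3 = x"
  "subst3 k x y z Y3 = y" "subst3 k x y z Z3 = z"
proof -
  interpret A: type_hom "\<lambda>p. poly (map_poly k p) x"
    by (rule type_hom_poly)
  interpret B: type_hom "\<lambda>q. poly (map_poly (\<lambda>p. poly (map_poly k p) x) q) y"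
    by (rule A.type_hom_poly)
  note [simp] = map_poly_pCons_hom A.map_poly_pCons_hom B.map_poly_pCons_hom
    hom_simps map_poly_1
  show "subst3 k x y z (C3 r) = k r" "subst3 k x y z X3 = x"
    "subst3 k x y z Y3 = y" "subst3 k x y z Z3 = z"
    by (simp_all add: subst3_def C3_def X3_def Y3_def Z3_def)
qed

end

text \<open>Constants and the three variables generate R[x,y,z]; the three inner inductions follow
  the layers of the iterated polynomial type.\<close>

lemma poly3_induct:
  assumes C: "\<And>r. Q (C3 r)" and X: "Q X3" and Y: "Q Y3" and Z: "Q Z3"
    and add: "\<And>P P'. Q P \<Longrightarrow> Q P' \<Longrightarrow> Q (P + P')"
    and mult: "\<And>P P'. Q P \<Longrightarrow> Q P' \<Longrightarrow> Q (P * P')"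
  shows "Q P"
proof -
  have 0: "Q 0"
    using C[of 0] by (simp add: C3_def)
  have 1: "Q [:[:p:]:]" for p :: "'a poly"
  proof (induction p)
    case (pCons r p)
    have "[:[:pCons r p:]:] = C3 r + X3 * [:[:p:]:]"
      by (simp add: C3_def X3_def)
    then show ?case
      using add[OF C mult[OF X pCons.IH]] by simp
  qed (use 0 in simp)
  have 2: "Q [:q:]" for q :: "'a poly poly"
  proof (induction q)
    case (pCons p q)
    have "[:pCons p q:] = [:[:p:]:] + Y3 * [:q:]"
      by (simp add: Y3_def)
    then show ?case
      using add[OF 1 mult[OF Y pCons.IH]] by simp
  qed (use 0 in simp)
  show ?thesis
  proof (induction P)
    case (pCons q P)
    have "pCons q P = [:q:] + Z3 * P"
      by (simp add: Z3_def)
    then show ?case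
      using add[OF 2 mult[OF Z pCons.IH]] by simp
  qed (use 0 in simp)
qed

lemma type_hom_eqI:
  assumes "type_hom f" "type_hom f'"
    and "\<And>r. f (C3 r) = f' (C3 r)" "f X3 = f' X3" "f Y3 = f' Y3" "f Z3 = f' Z3"
  shows "f P = f' P"
proof -
  interpret f: type_hom f by fact
  interpret f': type_hom f' by fact
  show ?thesis
    using assms(3-) by (induction P rule: poly3_induct) (simp_all add: f.hom_simps f'.hom_simps)
qed

lemma type_hom_C3: "type_hom C3"
  by unfold_locales (simp_all add: C3_def one_pCons)

interpretation C3: type_hom C3
  by (rule type_hom_C3)

interpretation subst: type_hom "subst3 C3 A B C"
  by (rule C3.type_hom_subst3)

lemma subst3_id: "subst3 C3 X3 Y3 Z3 P = P"
  by (rule type_hom_eqI[where f' = "\<lambda>P. P"]) (unfold_locales, simp_all)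

lemma eval3_pCons: "eval3 (pCons r p) P = C3 r + P * eval3 p P"
  by (simp add: eval3_def C3.map_poly_pCons_hom)

lemma eval3_0 [simp]: "eval3 0 P = 0"
  by (simp add: eval3_def)

lemma eval3_X3: "eval3 p X3 = [:[:p:]:]"
  by (induction p) (simp_all add: eval3_pCons C3_def X3_def)

lemma eval3_Y3: "eval3 p Y3 = [:map_poly (\<lambda>r. [:r:]) p:]"
  by (induction p) (simp_all add: eval3_pCons C3_def Y3_def map_poly_pCons)

lemma hom_eval3:
  assumes "type_hom f" "type_hom k" "\<And>r. f (C3 r) = k r"
  shows "f (eval3 p P) = poly (map_poly k p) (f P)"
proof -
  interpret f: type_hom f by fact
  interpret k: type_hom k by fact
  show ?thesis
    by (induction p) (simp_all add: eval3_pCons f.hom_simps k.map_poly_pCons_hom assms(3))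
qed

lemma subst3_eval3: "subst3 C3 A B C (eval3 p P) = eval3 p (subst3 C3 A B C P)"
  using hom_eval3[OF subst.type_hom_axioms C3.type_hom_axioms, of A B C p P] by (simp add: eval3_def)

text \<open>Since \<open>[:q:]\<close> is free of z, the value given to z may be changed to
  \<open>Z3\<close>, where the substitution is the identity.\<close>

lemma subst3_const: "subst3 C3 X3 Y3 C [:q:] = [:q:]"
proof -
  have "subst3 C3 X3 Y3 C [:q:] = subst3 C3 X3 Y3 Z3 [:q:]"
    by (simp add: subst3_def map_poly_pCons)
  then show ?thesis by (simp add: subst3_id)
qed


subsection \<open>Coordinate rings\<close>

definition srf :: "'a::idom poly poly \<Rightarrow> 'a poly3"
  where "srf g = X3 * Y3 * Z3 - [:g:]"

lemma ring_of_type_simps [simp]: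
  "carrier ring_of_type = UNIV" "x \<otimes>\<^bsub>ring_of_type\<^esub> y = x * y" "x \<oplus>\<^bsub>ring_of_type\<^esub> y = x + y"
  "\<one>\<^bsub>ring_of_type\<^esub> = 1" "\<zero>\<^bsub>ring_of_type\<^esub> = 0"
  by (simp_all add: ring_of_type_def)

lemma cring_ring_of_type: "cring (ring_of_type :: 'a::comm_ring_1 ring)"
proof (rule cringI)
  show "abelian_group (ring_of_type :: 'a ring)"
    by (rule abelian_groupI) (auto simp: add_ac intro!: exI[of _ "- x" for x :: 'a])
  show "Group.comm_monoid (ring_of_type :: 'a ring)"
    by (rule Group.comm_monoidI) (auto simp: mult_ac)
qed (simp add: distrib_right)

lemma surface_ideal_eq: "surface_ideal g = {P. srf g dvd P}"
  by (auto simp: surface_ideal_def cgenideal_def srf_def dvd_def mult.commute)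

lemma ideal_surface_ideal: "ideal (surface_ideal g) ring_of_type"
  unfolding surface_ideal_def by (rule cring.cgenideal_ideal[OF cring_ring_of_type]) simp

lemma cring_coord_ring: "cring (coord_ring g)"
  unfolding coord_ring_def by (rule ideal.quotient_is_cring[OF ideal_surface_ideal cring_ring_of_type])

lemma fn_hom: "fn g \<in> ring_hom ring_of_type (coord_ring g)"
  using ideal.rcos_ring_hom[OF ideal_surface_ideal] by (simp add: coord_ring_def fn_def[abs_def])

lemma fn_closed [simp]: "fn g P \<in> carrier (coord_ring g)"
  using ring_hom_closed[OF fn_hom] by simp

lemma fn_simps:
  "fn g P \<otimes>\<^bsub>coord_ring g\<^esub> fn g Q = fn g (P * Q)"
  "fn g P \<oplus>\<^bsub>coord_ring g\<^esub> fn g Q = fn g (P + Q)"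
  "\<one>\<^bsub>coord_ring g\<^esub> = fn g 1"
  using ring_hom_mult[OF fn_hom, of P Q] ring_hom_add[OF fn_hom, of P Q] ring_hom_one[OF fn_hom, of g]
  by simp_all

lemma carrier_coord_ring: "carrier (coord_ring g) = range (fn g)"
  by (auto simp: coord_ring_def fn_def FactRing_def A_RCOSETS_def' )

lemma carrier_coord_ringE:
  assumes "w \<in> carrier (coord_ring g)"
  obtains P where "w = fn g P"
  using assms by (auto simp: carrier_coord_ring)

text \<open>The ideal is principal, so identities between regular functions reduce to divisibility
  in R[x,y,z].\<close>

lemma fn_eq_iff: "fn g P = fn g Q \<longleftrightarrow> srf g dvd P - Q"
proof -
  have fn: "fn g P = {R + P |R. srf g dvd R}" for P
    by (auto simp: fn_def a_r_coset_def' surface_ideal_eq)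
  show ?thesis
  proof
    assume "fn g P = fn g Q"
    then have "0 + P \<in> {R + Q |R. srf g dvd R}"
      unfolding fn[symmetric] by (subst \<open>fn g P = fn g Q\<close>[symmetric]) (auto simp: fn)
    then show "srf g dvd P - Q" by auto
  next
    assume *: "srf g dvd P - Q"
    \<comment> \<open>Shifting the multiplier by \<open>P - Q\<close>, itself a multiple of
      \<open>srf g\<close>, turns an element of either coset into one of the other.\<close>
    have "R + P = (R + (P - Q)) + Q" "R + Q = (R - (P - Q)) + P" for R
      by simp_all
    then show "fn g P = fn g Q"
      unfolding fn using * by (metis (no_types, lifting) dvd_add dvd_diff)
  qed
qed

subsection \<open>Morphisms of surfaces\<close>

lemma Mor_ring_hom: "\<phi> \<in> Mor g g' \<Longrightarrow> \<phi> \<in> ring_hom (coord_ring g') (coord_ring g)"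
  by (simp add: Mor_def)

lemma Mor_C3: "\<phi> \<in> Mor g g' \<Longrightarrow> \<phi> (fn g' (C3 r)) = fn g (C3 r)"
  by (simp add: Mor_def)

lemma Mor_closed: "\<phi> \<in> Mor g g' \<Longrightarrow> \<phi> (fn g' P) \<in> carrier (coord_ring g)"
  by (rule ring_hom_closed[OF Mor_ring_hom fn_closed])

lemma Mor_add:
  "\<phi> \<in> Mor g g' \<Longrightarrow> \<phi> (fn g' (P + Q)) = \<phi> (fn g' P) \<oplus>\<^bsub>coord_ring g\<^esub> \<phi> (fn g' Q)"
  using ring_hom_add[OF Mor_ring_hom, of \<phi> g g' "fn g' P" "fn g' Q"] by (simp add: fn_simps)

lemma Mor_mult:
  "\<phi> \<in> Mor g g' \<Longrightarrow> \<phi> (fn g' (P * Q)) = \<phi> (fn g' P) \<otimes>\<^bsub>coord_ring g\<^esub> \<phi> (fn g' Q)"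
  using ring_hom_mult[OF Mor_ring_hom, of \<phi> g g' "fn g' P" "fn g' Q"] by (simp add: fn_simps)

lemma Mor_fnE:
  assumes "\<phi> \<in> Mor g g'"
  obtains Q where "\<phi> (fn g' P) = fn g Q"
  using Mor_closed[OF assms] by (rule carrier_coord_ringE)

text \<open>Pullback is substitution of representatives of the coordinates, because this holds on
  generators.\<close>

lemma Mor_subst:
  assumes "\<phi> \<in> Mor g g'" and "coords g' \<phi> = (fn g A, fn g B, fn g C)"
  shows "\<phi> (fn g' P) = fn g (subst3 C3 A B C P)"
  using assms by (induction P rule: poly3_induct)
    (auto simp: coords_def Mor_C3 Mor_add Mor_mult subst.hom_simps fn_simps)

lemma Mor_coordsE:
  assumes "\<phi> \<in> Mor g g'"
  obtains A B C where "coords g' \<phi> = (fn g A, fn g B, fn g C)"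
  using Mor_fnE[OF assms] unfolding coords_def by metis

lemma Mor_ext:
  assumes "\<phi> \<in> Mor g g'" "\<psi> \<in> Mor g g'" "\<And>P. \<phi> (fn g' P) = \<psi> (fn g' P)"
  shows "\<phi> = \<psi>"
proof (rule extensionalityI)
  show "\<phi> \<in> extensional (carrier (coord_ring g'))" "\<psi> \<in> extensional (carrier (coord_ring g'))"
    using assms by (auto simp: Mor_def)
qed (use assms(3) in \<open>auto simp: carrier_coord_ring\<close>)

lemma Mor_coords_eqI:
  assumes "\<phi> \<in> Mor g g'" "\<psi> \<in> Mor g g'" "coords g' \<phi> = coords g' \<psi>"
  shows "\<phi> = \<psi>"
proof -
  obtain A B C where c: "coords g' \<phi> = (fn g A, fn g B, fn g C)"
    using Mor_coordsE[OF assms(1)] .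
  show ?thesis
    by (rule Mor_ext[OF assms(1,2)])
      (simp add: Mor_subst[OF assms(1) c] Mor_subst[OF assms(2) c[unfolded assms(3)]])
qed

text \<open>The universal property of the quotient for bare functions, with extensionality arranged
  because \<open>Mor\<close> demands it.\<close>

lemma fn_liftE:
  assumes "\<And>P Q. srf g dvd P - Q \<Longrightarrow> f P = f Q"
  obtains e where "e \<in> extensional (carrier (coord_ring g))" "\<And>P. e (fn g P) = f P"
proof
  let ?e = "\<lambda>w\<in>carrier (coord_ring g). f (SOME P. fn g P = w)"
  \<comment> \<open>The representative picked by \<open>SOME\<close> is congruent to
    \<open>P\<close>, so the hypothesis removes the dependence on the choice.\<close>
  show "?e (fn g P) = f P" for P
    using someI[of "\<lambda>Q. fn g Q = fn g P" P]
    by (auto simp: fn_eq_iff[of g _ P] intro!: assms)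
qed (rule restrict_extensional)

text \<open>The triple satisfies the equation of the target on the source. Substitution therefore
  sends multiples of \<open>srf g'\<close> to multiples of \<open>srf g\<close> and descends to the
  quotients.\<close>

lemma Mor_exists:
  assumes "srf g dvd subst3 C3 A B C (srf g')"
  shows "\<exists>\<phi> \<in> Mor g g'. coords g' \<phi> = (fn g A, fn g B, fn g C)"
proof -
  have "fn g (subst3 C3 A B C P) = fn g (subst3 C3 A B C Q)" if "srf g' dvd P - Q" for P Q
    using dvd_trans[OF assms subst.hom_dvd[OF that]] by (simp add: fn_eq_iff subst.hom_diff)
  from fn_liftE[of g' "\<lambda>P. fn g (subst3 C3 A B C P)", OF this]
  obtain \<phi> where ext: "\<phi> \<in> extensional (carrier (coord_ring g'))"
    and \<phi>: "\<And>P. \<phi> (fn g' P) = fn g (subst3 C3 A B C P)"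
    by blast
  have "\<phi> \<in> ring_hom (coord_ring g') (coord_ring g)"
    by (rule ring_hom_memI)
      (auto simp: carrier_coord_ring fn_simps \<phi> subst.hom_simps)
  then show ?thesis
    by (intro bexI[of _ \<phi>]) (simp_all add: Mor_def ext \<phi> coords_def)
qed

text \<open>Coordinates determine a morphism, so the definite description in
  \<open>mor_of_coords\<close> is meaningful.\<close>

lemma mor_of_coords:
  assumes "srf g dvd subst3 C3 A B C (srf g')"
  shows "mor_of_coords g g' (fn g A, fn g B, fn g C) \<in> Mor g g'"
    and "coords g' (mor_of_coords g g' (fn g A, fn g B, fn g C)) = (fn g A, fn g B, fn g C)"
proof -
  have "\<exists>!\<phi>. \<phi> \<in> Mor g g' \<and> coords g' \<phi> = (fn g A, fn g B, fn g C)"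
    using Mor_exists[OF assms] Mor_coords_eqI by metis
  from theI'[OF this] show "mor_of_coords g g' (fn g A, fn g B, fn g C) \<in> Mor g g'"
    "coords g' (mor_of_coords g g' (fn g A, fn g B, fn g C)) = (fn g A, fn g B, fn g C)"
    unfolding mor_of_coords_def by blast+
qed

section \<open>Identity, composition and inverses of morphisms\<close>

lemma mor_id_Mor: "mor_id g \<in> Mor g g"
proof -
  have "mor_id g \<in> ring_hom (coord_ring g) (coord_ring g)"
    by (rule ring_hom_memI) (auto simp: mor_id_def carrier_coord_ring fn_simps)
  then show ?thesis by (simp add: Mor_def mor_id_def)
qed

lemma mor_id_apply: "mor_id g (fn g P) = fn g P"
  by (simp add: mor_id_def)

lemma mor_comp_apply: "mor_comp g \<psi> \<phi> (fn g P) = \<phi> (\<psi> (fn g P))"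
  by (simp add: mor_comp_def compose_def)

lemma mor_comp_Mor:
  assumes "\<phi> \<in> Mor g g'" "\<psi> \<in> Mor g' g''"
  shows "mor_comp g'' \<psi> \<phi> \<in> Mor g g''"
proof -
  have "\<phi> \<circ> \<psi> \<in> ring_hom (coord_ring g'') (coord_ring g)"
    using assms by (intro ring_hom_trans) (auto dest: Mor_ring_hom)
  then have "mor_comp g'' \<psi> \<phi> \<in> ring_hom (coord_ring g'') (coord_ring g)"
    \<comment> \<open>\<open>compose\<close> is restricted to the carrier, so transferring the
      homomorphism laws needs closure of the carrier under the operations.\<close>
    using cring.cring_simprules(1,5,6)[OF cring_coord_ring[of g'']]
    by (auto simp: mor_comp_def compose_def ring_hom_def Pi_def)
  then show ?thesis
    using assms by (simp add: Mor_def mor_comp_apply) (simp add: mor_comp_def)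
qed

lemma mutually_inverse_iff:
  assumes "\<phi> \<in> Mor g g'" "\<psi> \<in> Mor g' g"
  shows "mutually_inverse g g' \<phi> \<psi> \<longleftrightarrow>
    (\<forall>P. \<phi> (\<psi> (fn g P)) = fn g P) \<and> (\<forall>P. \<psi> (\<phi> (fn g' P)) = fn g' P)"
proof
  assume "mutually_inverse g g' \<phi> \<psi>"
  then show "(\<forall>P. \<phi> (\<psi> (fn g P)) = fn g P) \<and> (\<forall>P. \<psi> (\<phi> (fn g' P)) = fn g' P)"
    unfolding mutually_inverse_def by (metis mor_comp_apply mor_id_apply)
next
  assume "(\<forall>P. \<phi> (\<psi> (fn g P)) = fn g P) \<and> (\<forall>P. \<psi> (\<phi> (fn g' P)) = fn g' P)"
  then show "mutually_inverse g g' \<phi> \<psi>"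
    unfolding mutually_inverse_def using assms
    by (auto intro!: Mor_ext[OF mor_comp_Mor mor_id_Mor] simp: mor_comp_apply mor_id_apply)
qed

text \<open>Both composites are morphisms, and equal coordinates force equal morphisms, so only the
  three variables have to be tested.\<close>

lemma IsoI:
  assumes "\<phi> \<in> Mor g g'" "\<psi> \<in> Mor g' g"
    and "\<And>V. V \<in> {X3, Y3, Z3} \<Longrightarrow> \<phi> (\<psi> (fn g V)) = fn g V"
    and "\<And>V. V \<in> {X3, Y3, Z3} \<Longrightarrow> \<psi> (\<phi> (fn g' V)) = fn g' V"
  shows "\<phi> \<in> Iso g g'"
proof -
  have "mor_comp g \<psi> \<phi> = mor_id g" "mor_comp g' \<phi> \<psi> = mor_id g'"
    using assms
    by (auto intro!: Mor_coords_eqI[OF mor_comp_Mor mor_id_Mor]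
        simp: coords_def mor_comp_apply mor_id_apply)
  then show ?thesis
    using assms(1,2) by (auto simp: Iso_def mutually_inverse_def)
qed

lemma Iso_Mor: "\<phi> \<in> Iso g g' \<Longrightarrow> \<phi> \<in> Mor g g'"
  by (simp add: Iso_def)

lemma Iso_comp:
  assumes "\<phi> \<in> Iso g g'" "\<psi> \<in> Iso g' g''"
  shows "mor_comp g'' \<psi> \<phi> \<in> Iso g g''"
proof -
  obtain \<phi>' \<psi>' where *: "\<phi>' \<in> Mor g' g" "\<psi>' \<in> Mor g'' g'"
      "mutually_inverse g g' \<phi> \<phi>'" "mutually_inverse g' g'' \<psi> \<psi>'"
    using assms by (auto simp: Iso_def)
  note M = Iso_Mor[OF assms(1)] Iso_Mor[OF assms(2)] *(1,2)
  show ?thesis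
  proof (rule IsoI)
    show "mor_comp g'' \<psi> \<phi> \<in> Mor g g''" "mor_comp g \<phi>' \<psi>' \<in> Mor g'' g"
      using M by (auto intro: mor_comp_Mor)
  next
    fix V
    \<comment> \<open>A named representative of the intermediate function allows the restricted
      compositions to be unfolded.\<close>
    obtain Q where "\<phi>' (fn g V) = fn g' Q"
      using Mor_fnE[OF M(3)] .
    then show "mor_comp g'' \<psi> \<phi> (mor_comp g \<phi>' \<psi>' (fn g V)) = fn g V"
      using * M Mor_fnE[OF M(4), of Q] mutually_inverse_iff[OF M(1,3)] mutually_inverse_iff[OF M(2,4)]
      by (metis mor_comp_apply)
  next
    fix V
    obtain Q where "\<psi> (fn g'' V) = fn g' Q"
      using Mor_fnE[OF M(2)] .
    then show "mor_comp g \<phi>' \<psi>' (mor_comp g'' \<psi> \<phi> (fn g'' V)) = fn g'' V"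
      using * M Mor_fnE[OF M(1), of Q] mutually_inverse_iff[OF M(1,3)] mutually_inverse_iff[OF M(2,4)]
      by (metis mor_comp_apply)
  qed
qed

text \<open>Two-sided inverses are unique, which justifies the definite description.\<close>

lemma mor_inv:
  assumes "\<phi> \<in> Iso g g'"
  shows "mor_inv g g' \<phi> \<in> Mor g' g" "mutually_inverse g g' \<phi> (mor_inv g g' \<phi>)"
proof -
  have "\<psi> = \<psi>'" if *: "\<psi> \<in> Mor g' g" "mutually_inverse g g' \<phi> \<psi>"
      "\<psi>' \<in> Mor g' g" "mutually_inverse g g' \<phi> \<psi>'" for \<psi> \<psi>'
  proof (rule Mor_ext[OF *(1,3)])
    fix P
    obtain Q where "\<psi>' (fn g P) = fn g' Q"
      using Mor_fnE[OF *(3)] .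
    then show "\<psi> (fn g P) = \<psi>' (fn g P)"
      using * mutually_inverse_iff[OF Iso_Mor[OF assms]] by metis
  qed
  then have "\<exists>!\<psi>. \<psi> \<in> Mor g' g \<and> mutually_inverse g g' \<phi> \<psi>"
    using assms by (auto simp: Iso_def)
  from theI'[OF this] show "mor_inv g g' \<phi> \<in> Mor g' g" "mutually_inverse g g' \<phi> (mor_inv g g' \<phi>)"
    unfolding mor_inv_def by blast+
qed

lemma mor_inv_Iso:
  assumes "\<phi> \<in> Iso g g'"
  shows "mor_inv g g' \<phi> \<in> Iso g' g"
  using mor_inv[OF assms] Iso_Mor[OF assms] by (auto simp: Iso_def mutually_inverse_def)

section \<open>Iterates and infinite order\<close>

lemma pow_Aut_apply: "(\<sigma> [^]\<^bsub>Aut g\<^esub> k) (fn g P) = (\<sigma> ^^ k) (fn g P)" for k :: nat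
  by (induction k) (simp_all add: nat_pow_def Aut_def mor_comp_apply mor_id_apply)

lemma infinite_orderI:
  assumes "\<And>k. k > 0 \<Longrightarrow> (\<sigma> ^^ k) (fn g P) \<noteq> fn g P"
  shows "infinite_order (Aut g) \<sigma>"
  unfolding infinite_order_def
proof (intro allI impI notI)
  fix k :: nat
  assume "k > 0" "\<sigma> [^]\<^bsub>Aut g\<^esub> k = \<one>\<^bsub>Aut g\<^esub>"
  then show False
    using assms[of k] pow_Aut_apply[of g \<sigma> k P] by (simp add: Aut_def mor_id_apply)
qed

text \<open>On pullbacks the conjugate sends the image under \<open>\<phi>\<close> of a function to
  the image of its \<open>s\<close>-translate. As \<open>\<phi>\<close> is injective, it copies the
  orbit of \<open>fn g' P\<close> faithfully.\<close>

lemma infinite_order_conjugate: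
  assumes \<phi>: "\<phi> \<in> Iso g g'" and s: "s \<in> Mor g' g'"
    and order: "\<And>k. k > 0 \<Longrightarrow> (s ^^ k) (fn g' P) \<noteq> fn g' P"
  shows "infinite_order (Aut g) (mor_comp g (mor_inv g g' \<phi>) (mor_comp g' s \<phi>))"
    (is "infinite_order _ ?\<sigma>")
proof -
  let ?\<psi> = "mor_inv g g' \<phi>"
  note M = Iso_Mor[OF \<phi>] mor_inv(1)[OF \<phi>]
  have inv: "\<phi> (?\<psi> (fn g Q)) = fn g Q" "?\<psi> (\<phi> (fn g' Q)) = fn g' Q" for Q
    using mor_inv(2)[OF \<phi>] mutually_inverse_iff[OF M] by auto
  have step: "?\<sigma> (\<phi> (fn g' Q)) = \<phi> (s (fn g' Q))" for Q
    by (metis M mor_comp_apply inv(2) Mor_fnE)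
  have closed: "\<exists>Q. (s ^^ k) (fn g' P) = fn g' Q" for k
    by (induction k) (auto, metis Mor_fnE[OF s])
  have pow: "(?\<sigma> ^^ k) (\<phi> (fn g' P)) = \<phi> ((s ^^ k) (fn g' P))" for k
    using closed step by (induction k) (simp, metis comp_apply funpow.simps(2))
  obtain Q where Q: "\<phi> (fn g' P) = fn g Q"
    using Mor_fnE[OF M(1)] .
  show ?thesis
  proof (rule infinite_orderI)
    fix k :: nat
    assume "k > 0"
    then show "(?\<sigma> ^^ k) (fn g Q) \<noteq> fn g Q"
      using pow[of k] closed[of k] order inv(2) Q by metis
  qed
qed

subsection \<open>The polynomials \<open>a\<^sup>*\<close> and \<open>\<bar>a\<close>\<close>

lemma unit_inv:
  assumes "u dvd 1"
  shows "u * unit_inv u = (1 :: 'a::idom)"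
proof -
  obtain v where v: "u * v = 1"
    using assms by (metis dvd_def)
  have "w = v" if "u * w = 1" for w
    using that v by (metis mult.assoc mult.commute mult.right_neutral)
  then have "\<exists>!v. u * v = 1" using v by blast
  then show ?thesis unfolding unit_inv_def by (rule theI')
qed

lemma unit_mult_power: "u dvd 1 \<Longrightarrow> v dvd 1 \<Longrightarrow> u ^ n * v dvd (1 :: 'a::idom)"
  by (metis dvd_power_same mult_dvd_mono mult_1 power_one)

lemma pCons_star: "pCons (coeff a 0) (star a) = a"
  by (rule poly_eqI) (simp add: star_def coeff_pCons coeff_poly_shift split: nat.split)

lemma eval3_star: "eval3 a P = C3 (coeff a 0) + P * eval3 (star a) P"
  by (metis eval3_pCons pCons_star)

text \<open>The setting in which \<open>bar\<close> is an involution; \<open>degree_ge\<close> keeps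
  the truncated subtraction in its exponent \<open>n - 1\<close> exact.\<close>

locale unit_poly =
  fixes a :: "'a::idom poly"
  assumes degree_ge: "degree a \<ge> 1" and lead_unit: "lead_coeff a dvd 1" and const_unit: "coeff a 0 dvd 1"
begin

text \<open>The denominator in the definition of \<open>bar\<close>, named so that identities can be
  cleared of its inverse.\<close>

definition barscale :: 'a
  where "barscale = coeff a 0 ^ (degree a - 1) * lead_coeff a"

lemma barscale_unit: "barscale dvd 1"
  unfolding barscale_def by (rule unit_mult_power) (fact const_unit lead_unit)+

lemma barscale_inv: "barscale * unit_inv barscale = 1"
  by (rule unit_inv) (rule barscale_unit)

lemma bar_eq: "bar a = smult (unit_inv barscale)
    (\<Sum>i\<le>degree a. monom (coeff a i * coeff a 0 ^ i) (degree a - i))"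
  by (simp add: bar_def barscale_def Let_def)

lemma smult_bar: "smult barscale (bar a) =
    (\<Sum>i\<le>degree a. monom (coeff a i * coeff a 0 ^ i) (degree a - i))"
  by (simp add: bar_eq barscale_inv)

lemma coeff_bar: "coeff (bar a) j =
    (if j \<le> degree a then unit_inv barscale * coeff a (degree a - j) * coeff a 0 ^ (degree a - j) else 0)"
proof -
  \<comment> \<open>For \<open>i \<le> degree a\<close> the truncated difference
    \<open>degree a - i\<close> equals \<open>j\<close> exactly when \<open>i = degree a - j\<close>
    and \<open>j \<le> degree a\<close>.\<close>
  have "(\<Sum>i\<le>degree a. coeff (monom (coeff a i * coeff a 0 ^ i) (degree a - i)) j) =
    (\<Sum>i\<le>degree a. if i = degree a - j \<and> j \<le> degree a then coeff a i * coeff a 0 ^ i else 0)"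
    by (intro sum.cong) auto
  then show ?thesis
    by (auto simp: bar_eq coeff_sum)
qed

lemma const_power: "coeff a 0 ^ degree a = coeff a 0 * coeff a 0 ^ (degree a - 1)"
  using degree_ge by (cases "degree a") auto

text \<open>The scaling is chosen for this: the constant term before scaling is
  \<open>barscale * coeff a 0\<close>.\<close>

lemma coeff_bar_0: "coeff (bar a) 0 = coeff a 0"
proof -
  have "coeff (bar a) 0 = (barscale * unit_inv barscale) * coeff a 0"
    by (simp add: coeff_bar const_power barscale_def mult_ac)
  then show ?thesis by (simp add: barscale_inv)
qed

lemma coeff_bar_degree: "coeff (bar a) (degree a) = unit_inv barscale * coeff a 0"
  by (simp add: coeff_bar)

lemma coeff_bar_degree_unit: "coeff (bar a) (degree a) dvd 1"
proof -
  have "unit_inv barscale dvd 1"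
    using barscale_inv by (metis dvd_triv_right)
  then show ?thesis
    using const_unit unfolding coeff_bar_degree by (metis mult_dvd_mono mult_1)
qed

lemma degree_bar: "degree (bar a) = degree a"
proof (rule antisym)
  show "degree (bar a) \<le> degree a"
    by (rule degree_le) (simp add: coeff_bar)
  show "degree a \<le> degree (bar a)"
    using coeff_bar_degree_unit by (intro le_degree) auto
qed

lemma unit_poly_bar: "unit_poly (bar a)"
  using degree_ge const_unit coeff_bar_degree_unit
  by unfold_locales (simp_all add: degree_bar coeff_bar_0)

text \<open>Reversing twice restores the coefficients, up to powers of the constant term that
  combine to its \<open>degree a\<close>-th power and cancel against the two scalings.\<close>

lemma bar_bar: "bar (bar a) = a"
proof -
  interpret bar: unit_poly "bar a" by (rule unit_poly_bar)
  let ?u = "unit_inv bar.barscale" and ?v = "unit_inv barscale" and ?c = "coeff a 0"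
  have s: "bar.barscale = ?v * ?c ^ degree a"
    by (simp add: bar.barscale_def degree_bar coeff_bar_0 coeff_bar_degree const_power mult_ac)
  show ?thesis
  proof (rule poly_eqI)
    fix j
    show "coeff (bar (bar a)) j = coeff a j"
    proof (cases "j \<le> degree a")
      case True
      then have "?c ^ j * ?c ^ (degree a - j) = ?c ^ degree a"
        by (simp add: power_add[symmetric])
      then have "coeff (bar (bar a)) j = (?v * ?c ^ degree a) * ?u * coeff a j"
        using True
        by (simp add: bar.coeff_bar degree_bar coeff_bar_0) (simp add: coeff_bar mult_ac)
      then show ?thesis by (simp add: s[symmetric] bar.barscale_inv)
    next
      case False
      then show ?thesis
        by (simp add: bar.coeff_bar degree_bar coeff_eq_0)
    qed
  qed
qed

end

section \<open>Evaluation of the reversed polynomial and the flip identities\<close>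

lemma eval3_hom: "type_hom (\<lambda>p. eval3 p P)"
  unfolding eval3_def by (rule C3.type_hom_poly)

lemma eval3_monom: "eval3 (monom r i) P = C3 r * P ^ i"
  by (simp add: eval3_def map_poly_monom C3.hom_zero poly_monom)

lemma eval3_smult: "eval3 (smult r p) P = C3 r * eval3 p P"
  by (simp add: eval3_def C3.map_poly_smult_hom)

lemma eval3_sum: "eval3 (\<Sum>i\<in>I. f i) P = (\<Sum>i\<in>I. eval3 (f i) P)"
proof -
  interpret type_hom "\<lambda>p. eval3 p P" by (rule eval3_hom)
  show ?thesis by (induction I rule: infinite_finite_induct) (simp_all add: hom_simps)
qed

lemma eval3_altdef: "eval3 p P = (\<Sum>i\<le>degree p. C3 (coeff p i) * P ^ i)"
  using eval3_sum[of "\<lambda>i. monom (coeff p i) i" "{..degree p}" P]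
  by (simp add: eval3_monom poly_as_sum_of_monoms)

lemma C3_power: "C3 (r ^ n) = C3 r ^ n"
  by (induction n) (simp_all add: C3.hom_simps)

context unit_poly
begin

text \<open>A division-free form of the definition of \<open>bar\<close>: each term of
  \<open>w ^ n * a(x)\<close> is a coefficient times \<open>(x * w) ^ i * w ^ (n - i)\<close>, and
  modulo the left side \<open>x * w\<close> is the constant term.\<close>

lemma bar_reflection:
  "x * w - C3 (coeff a 0) dvd w ^ degree a * eval3 a x - C3 barscale * eval3 (bar a) w"
proof -
  let ?c = "C3 (coeff a 0)" and ?n = "degree a"
  have 1: "C3 barscale * eval3 (bar a) w = (\<Sum>i\<le>?n. C3 (coeff a i) * ?c ^ i * w ^ (?n - i))"
    by (simp add: eval3_smult[symmetric] smult_bar eval3_sum eval3_monom C3.hom_mult C3_power)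
  have "w ^ ?n = w ^ i * w ^ (?n - i)" if "i \<le> ?n" for i
    using that by (simp add: power_add[symmetric])
  then have 2: "w ^ ?n * eval3 a x = (\<Sum>i\<le>?n. C3 (coeff a i) * (x * w) ^ i * w ^ (?n - i))"
    unfolding eval3_altdef sum_distrib_left
    by (intro sum.cong refl) (simp add: power_mult_distrib mult_ac)
  have "w ^ ?n * eval3 a x - C3 barscale * eval3 (bar a) w
      = (\<Sum>i\<le>?n. C3 (coeff a i) * w ^ (?n - i) * ((x * w) ^ i - ?c ^ i))"
    unfolding 1 2 sum_subtractf[symmetric] by (intro sum.cong refl) (simp add: algebra_simps)
  also have "x * w - ?c dvd \<dots>"
    \<comment> \<open>A difference of equal powers is divisible by the difference of the
      bases.\<close>
    by (intro dvd_sum dvd_mult) (simp add: power_diff_sumr2)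
  finally show ?thesis .
qed

text \<open>
  Modulo \<open>y\<close>, multiplication by the unit \<open>c = x w\<close> turns \<open>\<bar>a\<^sup>*(w) + x\<close> into \<open>x \<bar>a(w)\<close>. The factor \<open>barscale\<close>
  is then needed to compare \<open>\<bar>a(w)\<close> with \<open>w\<^sup>n a(x)\<close>.
\<close>

lemma flip_quotient_exists:
  assumes "coeff b 0 = coeff a 0"
    and F: "F = x * y * z - (eval3 a x + eval3 b y - C3 (coeff a 0))"
    and w: "w = y * z - eval3 (star a) x"
  shows "\<exists>U. F dvd y * U - (eval3 (star (bar a)) w + x)"
proof -
  let ?c = "C3 (coeff a 0)"
  let ?D = "\<lambda>P. \<exists>U. F dvd y * U - P"
  define T where "T = x * w - ?c"
  obtain q where q: "w ^ degree a * eval3 a x - C3 barscale * eval3 (bar a) w = T * q"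
    using bar_reflection[of x w] by (auto simp: T_def dvd_def)
  have a: "eval3 a x = ?c + x * eval3 (star a) x"
    and b: "eval3 b y = ?c + y * eval3 (star b) y"
    and a': "eval3 (bar a) w = ?c + w * eval3 (star (bar a)) w"
    using eval3_star[of a] eval3_star[of b] eval3_star[of "bar a"] assms(1)
    by (simp_all add: coeff_bar_0)
  \<comment> \<open>Up to multiples of \<open>F\<close>, both \<open>T\<close> and
    \<open>eval3 a x\<close> are divisible by \<open>y\<close>; these are the only two terms left in
    \<open>eq\<close> below.\<close>
  have T: "T = y * eval3 (star b) y + F"
    by (simp add: T_def F w a b algebra_simps)
  have ax: "eval3 a x = y * (x * z - eval3 (star b) y) - F"
    by (simp add: F b algebra_simps)
  define E where "E = eval3 (star (bar a)) w"
  \<comment> \<open>Use \<open>?c * E = x * w * E - T * E\<close>, and recognise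
    \<open>?c + w * E\<close> as the value of \<open>bar a\<close> at \<open>w\<close>.\<close>
  have "C3 barscale * ?c * (E + x)
      = x * (C3 barscale * eval3 (bar a) w) - T * (C3 barscale * E)"
    by (simp add: a' T_def E_def algebra_simps)
  also have "C3 barscale * eval3 (bar a) w = w ^ degree a * eval3 a x - T * q"
    using q by (simp add: algebra_simps)
  finally have eq: "C3 barscale * ?c * (E + x) =
      (x * w ^ degree a) * eval3 a x - T * (x * q + C3 barscale * E)"
    by (simp add: algebra_simps)
  obtain u where u: "barscale * coeff a 0 * u = 1"
    using unit_mult_power[OF barscale_unit const_unit, of 1] by (auto simp: dvd_def)
  then have "C3 u * (C3 barscale * ?c) = 1"
    by (simp flip: C3.hom_mult C3.hom_one) (simp add: mult_ac)
  then have eq': "E + x = C3 u * (x * w ^ degree a) * eval3 a x - T * (C3 u * (x * q + C3 barscale * E))"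
    by (metis (no_types, lifting) eq mult.assoc mult.commute mult_1 right_diff_distrib)
  let ?G = "C3 u * (x * w ^ degree a)" and ?H = "C3 u * (x * q + C3 barscale * E)"
  \<comment> \<open>The quotient is read off from \<open>eq'\<close> by inserting \<open>T\<close>
    and \<open>ax\<close> and collecting the multiples of \<open>y\<close>.\<close>
  have "y * (?G * (x * z - eval3 (star b) y) - ?H * eval3 (star b) y) - (E + x) = F * (?G + ?H)"
    unfolding eq' T ax by (simp only: algebra_simps)
  then show ?thesis
    unfolding E_def by (metis dvd_triv_left)
qed

text \<open>Multiply the relation defining \<open>U\<close> by \<open>w\<close>: modulo
  \<open>F\<close> one has \<open>w * x = b(y)\<close>, while \<open>w\<close> times the value of
  \<open>star (bar a)\<close> at \<open>w\<close> is the value of \<open>bar a\<close> minus the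
  constant term.\<close>

lemma flip_surface:
  assumes F: "F = x * y * z - (eval3 a x + eval3 b y - C3 (coeff a 0))"
    and w: "w = y * z - eval3 (star a) x"
    and U: "F dvd y * U - (eval3 (star (bar a)) w + x)"
  shows "F dvd w * y * U - (eval3 (bar a) w + eval3 b y - C3 (coeff a 0))"
proof -
  have a: "eval3 a x = C3 (coeff a 0) + x * eval3 (star a) x"
    and a': "eval3 (bar a) w = C3 (coeff a 0) + w * eval3 (star (bar a)) w"
    using eval3_star[of a] eval3_star[of "bar a"] by (simp_all add: coeff_bar_0)
  have "w * x - eval3 b y = F"
    unfolding F w a by (simp add: algebra_simps)
  then have "w * y * U - (eval3 (bar a) w + eval3 b y - C3 (coeff a 0))
      = w * (y * U - (eval3 (star (bar a)) w + x)) + F"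
    unfolding a' by (auto simp: algebra_simps)
  then show ?thesis using U by (metis dvd_add dvd_mult dvd_refl)
qed

end

lemma admissible_iff: "admissible a b \<longleftrightarrow> degree a \<ge> 3 \<and> degree b \<ge> 3 \<and> unit_poly a \<and> unit_poly b
    \<and> coeff a 0 = coeff b 0"
  by (auto simp: admissible_def unit_poly_def poly_0_coeff_0)

lemma admissible_bar:
  assumes "admissible a b"
  shows "admissible (bar a) b" "admissible a (bar b)"
  using assms unit_poly.degree_bar unit_poly.unit_poly_bar unit_poly.coeff_bar_0
  unfolding admissible_iff by metis+

lemma srf_S: "srf (S a b) = X3 * Y3 * Z3 - (eval3 a X3 + eval3 b Y3 - C3 (coeff a 0))"
  by (simp add: srf_def S_def eval3_X3 eval3_Y3 C3_def poly_0_coeff_0)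

lemma subst_srf_S: "subst3 C3 A B C (srf (S a b)) = A * B * C - (eval3 a A + eval3 b B - C3 (coeff a 0))"
  by (simp add: srf_S subst.hom_simps subst3_eval3)


subsection \<open>Division of regular functions\<close>

text \<open>This makes \<open>D\<close> a non-zero-divisor on the surface without first proving that
  the coordinate ring is a domain.\<close>

definition divisor_on :: "'a::idom poly poly \<Rightarrow> 'a poly3 \<Rightarrow> bool"
  where "divisor_on g D \<longleftrightarrow> prime_elem D \<and> \<not> D dvd srf g"

lemma divisor_on_cancel:
  assumes "divisor_on g D" "fn g (D * P) = fn g (D * Q)"
  shows "fn g P = fn g Q"
proof -
  have "srf g dvd D * (P - Q)"
    using assms(2) by (simp add: fn_eq_iff right_diff_distrib)
  then obtain K where K: "D * (P - Q) = srf g * K" by (auto simp: dvd_def)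
  then have "D dvd srf g * K" by (metis dvd_triv_left)
  then have "D dvd K"
    using assms(1) by (auto simp: divisor_on_def prime_elem_dvd_mult_iff)
  then obtain K' where "K = D * K'" by (auto simp: dvd_def)
  then have "D * (P - Q) = D * (srf g * K')" using K by (simp add: mult_ac)
  then have "P - Q = srf g * K'"
    using assms(1) unfolding divisor_on_def prime_elem_def by (metis mult_left_cancel)
  then show ?thesis by (simp add: fn_eq_iff)
qed

text \<open>Cancellation of \<open>D\<close> gives uniqueness of the quotient, and \<open>U\<close>
  gives existence.\<close>

lemma is_quotient_iff:
  assumes "divisor_on g D" "srf g dvd D * U - N"
  shows "is_quotient g N D w \<longleftrightarrow> w = fn g U"
proof
  assume w: "is_quotient g N D w"
  then obtain P where P: "w = fn g P"
    by (auto simp: is_quotient_def elim: carrier_coord_ringE)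
  then have "fn g (D * P) = fn g (D * U)"
    using w assms(2) by (simp add: is_quotient_def fn_simps flip: fn_eq_iff)
  then show "w = fn g U" using divisor_on_cancel[OF assms(1)] P by blast
next
  assume "w = fn g U"
  then show "is_quotient g N D w"
    using assms(2) by (simp add: is_quotient_def fn_simps flip: fn_eq_iff)
qed

lemma quotient_eq:
  assumes "divisor_on g D" "srf g dvd D * U - N"
  shows "\<exists>!w. is_quotient g N D w" "quotient g N D = fn g U"
  unfolding quotient_def is_quotient_iff[OF assms] by simp_all

lemma prime_elem_X: "prime_elem [:0, 1 :: 'a::idom:]"
proof -
  have "[:0, 1:] dvd p \<longleftrightarrow> poly p 0 = 0" for p :: "'a poly"
    using poly_eq_0_iff_dvd[of p 0] by simp
  then show ?thesis
    by (auto simp: prime_elem_def)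
qed

lemma divisor_on_Y3:
  assumes "coeff g 0 \<noteq> 0"
  shows "divisor_on g Y3"
proof -
  have "\<not> Y3 dvd srf g"
  proof
    assume "Y3 dvd srf g"
    \<comment> \<open>Setting y to 0 in the equation leaves only g(x,0), up to sign.\<close>
    then have "Y3 dvd X3 * Y3 * Z3 - srf g" by (intro dvd_diff) simp_all
    then have "[:0, 1:] dvd g"
      by (simp add: srf_def Y3_def)
    then have "poly g 0 = 0"
      using poly_eq_0_iff_dvd[of g 0] by simp
    then show False using assms by (simp add: poly_0_coeff_0)
  qed
  then show ?thesis
    unfolding divisor_on_def Y3_def by (metis lift_prime_elem_poly prime_elem_X)
qed

lemma divisor_on_X3:
  assumes "poly (coeff g j) 0 \<noteq> 0"
  shows "divisor_on g X3"
proof -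
  have "\<not> X3 dvd srf g"
  proof
    assume "X3 dvd srf g"
    then have "X3 dvd X3 * Y3 * Z3 - srf g" by (intro dvd_diff) (simp_all add: mult.assoc)
    then have "[:[:0, 1:]:] dvd g"
      by (simp add: srf_def X3_def)
    then have "[:0, 1:] dvd coeff g j"
      by (simp add: const_poly_dvd_iff)
    then show False
      using assms poly_eq_0_iff_dvd[of "coeff g j" 0] by simp
  qed
  then show ?thesis
    \<comment> \<open>Primality of the variable in R[x] is lifted through the two outer polynomial
      layers.\<close>
    unfolding divisor_on_def X3_def by (metis lift_prime_elem_poly prime_elem_X)
qed

lemma divisor_on_S:
  assumes "admissible a b"
  shows "divisor_on (S a b) X3" "divisor_on (S a b) Y3"
proof -
  \<comment> \<open>Since b(0) = c, the y-free part of \<open>S a b\<close> is \<open>a\<close>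
    itself, whose constant term is a unit.\<close>
  have "coeff a 0 = coeff b 0" "coeff a 0 \<noteq> 0" "a \<noteq> 0"
    using assms by (auto simp: admissible_iff unit_poly_def)
  then show "divisor_on (S a b) X3" "divisor_on (S a b) Y3"
    by (auto intro!: divisor_on_X3[of _ 0] divisor_on_Y3
        simp: S_def coeff_map_poly poly_0_coeff_0)
qed

subsection \<open>The maps \<open>\<sigma>\<^sub>x\<close>, \<open>\<sigma>\<^sub>y\<close> and the shear\<close>

text \<open>Needed because the second flip recovers a coordinate only modulo the surface
  equation.\<close>

lemma eval3_cong: "D dvd P - Q \<Longrightarrow> D dvd eval3 p P - eval3 p Q"
proof (induction p)
  case (pCons r p)
  have "eval3 (pCons r p) P - eval3 (pCons r p) Q
      = (P - Q) * eval3 p P + Q * (eval3 p P - eval3 p Q)"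
    by (simp add: eval3_pCons algebra_simps)
  then show ?case
    using pCons by (metis dvd_add dvd_mult dvd_mult2)
qed simp

context
  fixes p q :: "'a::idom poly"
  assumes adm: "admissible p q"
begin

text \<open>Regularity of the quotient and the target equation together show that the definite
  descriptions behind \<open>sigma_y\<close> denote. Only the class of \<open>U\<close> is
  canonical.\<close>

lemma sigma_y_exists:
  obtains U where "srf (S p q) dvd Y3 * U - znum_y p"
    and "\<exists>!w. is_quotient (S p q) (znum_y p) Y3 w"
    and "sigma_y_coords p q = (fn (S p q) (xbar_y p), fn (S p q) Y3, fn (S p q) U)"
    and "sigma_y p q \<in> Mor (S p q) (S (bar p) q)"
    and "coords (S (bar p) q) (sigma_y p q) = sigma_y_coords p q"
proof -
  interpret unit_poly p using adm by (simp add: admissible_iff)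
  have c: "coeff q 0 = coeff p 0" using adm by (simp add: admissible_iff)
  obtain U where U: "srf (S p q) dvd Y3 * U - znum_y p"
    using flip_quotient_exists[OF c srf_S xbar_y_def] by (auto simp: znum_y_def)
  note quo = quotient_eq[OF divisor_on_S(2)[OF adm] U]
  have co: "sigma_y_coords p q = (fn (S p q) (xbar_y p), fn (S p q) Y3, fn (S p q) U)"
    by (simp add: sigma_y_coords_def quo(2))
  have "srf (S p q) dvd subst3 C3 (xbar_y p) Y3 U (srf (S (bar p) q))"
    unfolding subst_srf_S coeff_bar_0
    by (rule flip_surface[OF srf_S xbar_y_def U[unfolded znum_y_def]])
  note M = mor_of_coords[OF this, folded co sigma_y_def]
  show ?thesis by (rule that[OF U quo(1) co M])
qed

lemma sigma_x_exists:
  obtains U where "srf (S p q) dvd X3 * U - znum_x q"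
    and "\<exists>!w. is_quotient (S p q) (znum_x q) X3 w"
    and "sigma_x_coords p q = (fn (S p q) X3, fn (S p q) (ybar_x q), fn (S p q) U)"
    and "sigma_x p q \<in> Mor (S p q) (S p (bar q))"
    and "coords (S p (bar q)) (sigma_x p q) = sigma_x_coords p q"
proof -
  interpret unit_poly q using adm by (simp add: admissible_iff)
  have c: "coeff p 0 = coeff q 0" using adm by (simp add: admissible_iff)
  \<comment> \<open>The equal constant terms make the equation symmetric, so the flip lemmas apply
    with x and y interchanged.\<close>
  have F: "srf (S p q) = Y3 * X3 * Z3 - (eval3 q Y3 + eval3 p X3 - C3 (coeff q 0))"
    by (simp add: srf_S c algebra_simps)
  obtain U where U: "srf (S p q) dvd X3 * U - znum_x q"
    using flip_quotient_exists[OF c F ybar_x_def] by (auto simp: znum_x_def)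
  note quo = quotient_eq[OF divisor_on_S(1)[OF adm] U]
  have co: "sigma_x_coords p q = (fn (S p q) X3, fn (S p q) (ybar_x q), fn (S p q) U)"
    by (simp add: sigma_x_coords_def quo(2))
  have "srf (S p q) dvd subst3 C3 X3 (ybar_x q) U (srf (S p (bar q)))"
    using flip_surface[OF F ybar_x_def U[unfolded znum_x_def]]
    by (simp add: subst_srf_S c algebra_simps)
  note M = mor_of_coords[OF this, folded co sigma_x_def]
  show ?thesis by (rule that[OF U quo(1) co M])
qed

lemma bar_bar: "bar (bar p) = p" "bar (bar q) = q"
proof -
  have "unit_poly p" "unit_poly q"
    using adm by (simp_all add: admissible_iff)
  then show "bar (bar p) = p" "bar (bar q) = q"
    by (simp_all add: unit_poly.bar_bar)
qed

end

text \<open>The relation defining the new z, solved for x, says that the second flip returns x. The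
  old z then returns after cancelling y.\<close>

lemma sigma_y_sigma_y:
  assumes adm: "admissible p q" and V: "V \<in> {X3, Y3, Z3}"
  shows "sigma_y p q (sigma_y (bar p) q (fn (S p q) V)) = fn (S p q) V"
proof -
  let ?g = "S p q" and ?g' = "S (bar p) q"
  note adm' = admissible_bar(1)[OF adm]
  note bb = bar_bar(1)[OF adm]
  obtain U where U: "srf ?g dvd Y3 * U - znum_y p"
    "sigma_y_coords p q = (fn ?g (xbar_y p), fn ?g Y3, fn ?g U)"
    "sigma_y p q \<in> Mor ?g ?g'" "coords ?g' (sigma_y p q) = sigma_y_coords p q"
    using sigma_y_exists[OF adm] by metis
  obtain U' where U': "srf ?g' dvd Y3 * U' - znum_y (bar p)"
    "sigma_y_coords (bar p) q = (fn ?g' (xbar_y (bar p)), fn ?g' Y3, fn ?g' U')"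
    "coords ?g (sigma_y (bar p) q) = sigma_y_coords (bar p) q"
    using sigma_y_exists[OF adm'] unfolding bb by metis
  let ?s = "subst3 C3 (xbar_y p) Y3 U"
  note \<phi> = Mor_subst[OF U(3) U(4)[unfolded U(2)]]
  have \<psi>: "sigma_y (bar p) q (fn ?g X3) = fn ?g' (xbar_y (bar p))"
    "sigma_y (bar p) q (fn ?g Y3) = fn ?g' Y3"
    "sigma_y (bar p) q (fn ?g Z3) = fn ?g' U'"
    using U'(2,3) by (simp_all add: coords_def)
  have X: "srf ?g dvd ?s (xbar_y (bar p)) - X3"
    using U(1) by (simp add: xbar_y_def[of "bar p"] znum_y_def subst.hom_simps subst3_eval3 algebra_simps)
  have "fn ?g (?s (Y3 * U')) = fn ?g (?s (znum_y (bar p)))"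
    using U'(1) by (simp add: fn_eq_iff[symmetric] \<phi>[symmetric])
  \<comment> \<open>The second numerator becomes a*(x) plus the flipped x, which is
    \<open>Y3 * Z3\<close> by \<open>xbar_y_def\<close>; \<open>bb\<close> turns the doubly barred
    polynomial back into \<open>p\<close>.\<close>
  also have "\<dots> = fn ?g (Y3 * Z3)"
    using eval3_cong[OF X, of "star p"]
    by (simp add: fn_eq_iff znum_y_def bb subst.hom_simps subst3_eval3)
      (simp add: xbar_y_def algebra_simps)
  finally have "fn ?g (Y3 * ?s U') = fn ?g (Y3 * Z3)"
    by (simp add: subst.hom_mult)
  then have "fn ?g (?s U') = fn ?g Z3"
    by (rule divisor_on_cancel[OF divisor_on_S(2)[OF adm]])
  then show ?thesis
    using V X[folded fn_eq_iff] by (elim insertE emptyE) (simp_all add: \<phi> \<psi>)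
qed

lemma sigma_x_sigma_x:
  assumes adm: "admissible p q" and V: "V \<in> {X3, Y3, Z3}"
  shows "sigma_x p q (sigma_x p (bar q) (fn (S p q) V)) = fn (S p q) V"
proof -
  let ?g = "S p q" and ?g' = "S p (bar q)"
  note adm' = admissible_bar(2)[OF adm]
  note bb = bar_bar(2)[OF adm]
  obtain U where U: "srf ?g dvd X3 * U - znum_x q"
    "sigma_x_coords p q = (fn ?g X3, fn ?g (ybar_x q), fn ?g U)"
    "sigma_x p q \<in> Mor ?g ?g'" "coords ?g' (sigma_x p q) = sigma_x_coords p q"
    using sigma_x_exists[OF adm] by metis
  obtain U' where U': "srf ?g' dvd X3 * U' - znum_x (bar q)"
    "sigma_x_coords p (bar q) = (fn ?g' X3, fn ?g' (ybar_x (bar q)), fn ?g' U')"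
    "coords ?g (sigma_x p (bar q)) = sigma_x_coords p (bar q)"
    using sigma_x_exists[OF adm'] unfolding bb by metis
  let ?s = "subst3 C3 X3 (ybar_x q) U"
  note \<phi> = Mor_subst[OF U(3) U(4)[unfolded U(2)]]
  have \<psi>: "sigma_x p (bar q) (fn ?g Y3) = fn ?g' (ybar_x (bar q))"
    "sigma_x p (bar q) (fn ?g X3) = fn ?g' X3"
    "sigma_x p (bar q) (fn ?g Z3) = fn ?g' U'"
    using U'(2,3) by (simp_all add: coords_def)
  have Y: "srf ?g dvd ?s (ybar_x (bar q)) - Y3"
    using U(1) by (simp add: ybar_x_def[of "bar q"] znum_x_def subst.hom_simps subst3_eval3 algebra_simps)
  have "fn ?g (?s (X3 * U')) = fn ?g (?s (znum_x (bar q)))"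
    using U'(1) by (simp add: fn_eq_iff[symmetric] \<phi>[symmetric])
  also have "\<dots> = fn ?g (X3 * Z3)"
    using eval3_cong[OF Y, of "star q"]
    by (simp add: fn_eq_iff znum_x_def bb subst.hom_simps subst3_eval3)
      (simp add: ybar_x_def algebra_simps)
  finally have "fn ?g (X3 * ?s U') = fn ?g (X3 * Z3)"
    by (simp add: subst.hom_mult)
  then have "fn ?g (?s U') = fn ?g Z3"
    by (rule divisor_on_cancel[OF divisor_on_S(1)[OF adm]])
  then show ?thesis
    using V Y[folded fn_eq_iff] by (elim insertE emptyE) (simp_all add: \<phi> \<psi>)
qed

lemma sigma_y_Iso:
  assumes "admissible p q"
  shows "sigma_y p q \<in> Iso (S p q) (S (bar p) q)"
proof (rule IsoI)
  note adm' = admissible_bar(1)[OF assms]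
  note bb = bar_bar(1)[OF assms]
  show "sigma_y p q \<in> Mor (S p q) (S (bar p) q)"
    using sigma_y_exists[OF assms] by metis
  show "sigma_y (bar p) q \<in> Mor (S (bar p) q) (S p q)"
    using sigma_y_exists[OF adm'] unfolding bb by metis
  show "sigma_y p q (sigma_y (bar p) q (fn (S p q) V)) = fn (S p q) V" if "V \<in> {X3, Y3, Z3}" for V
    using sigma_y_sigma_y[OF assms that] .
  show "sigma_y (bar p) q (sigma_y p q (fn (S (bar p) q) V)) = fn (S (bar p) q) V"
    if "V \<in> {X3, Y3, Z3}" for V
    using sigma_y_sigma_y[OF adm' that] unfolding bb .
qed

lemma sigma_x_Iso:
  assumes "admissible p q"
  shows "sigma_x p q \<in> Iso (S p q) (S p (bar q))"
proof (rule IsoI)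
  note adm' = admissible_bar(2)[OF assms]
  note bb = bar_bar(2)[OF assms]
  show "sigma_x p q \<in> Mor (S p q) (S p (bar q))"
    using sigma_x_exists[OF assms] by metis
  show "sigma_x p (bar q) \<in> Mor (S p (bar q)) (S p q)"
    using sigma_x_exists[OF adm'] unfolding bb by metis
  show "sigma_x p q (sigma_x p (bar q) (fn (S p q) V)) = fn (S p q) V" if "V \<in> {X3, Y3, Z3}" for V
    using sigma_x_sigma_x[OF assms that] .
  show "sigma_x p (bar q) (sigma_x p q (fn (S p (bar q)) V)) = fn (S p (bar q)) V"
    if "V \<in> {X3, Y3, Z3}" for V
    using sigma_x_sigma_x[OF adm' that] unfolding bb .
qed

text \<open>Monomials are free of y, free of x, or divisible by xy; the constant belongs to the
  first two groups and is therefore subtracted once.\<close>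

lemma xy_decomposition:
  "g = [:x_part g:] + map_poly (\<lambda>r. [:r:]) (y_part g) - [:[:poly (poly g 0) 0:]:]
    + [:[:0, 1:]:] * [:0, 1:] * xy_part g"
proof -
  have "coeff (coeff g j) i = coeff (coeff ([:x_part g:] + map_poly (\<lambda>r. [:r:]) (y_part g)
      - [:[:poly (poly g 0) 0:]:] + [:[:0, 1:]:] * [:0, 1:] * xy_part g) j) i" for i j
    by (simp add: x_part_def y_part_def xy_part_def coeff_map_poly coeff_pCons coeff_poly_shift
        poly_0_coeff_0 split: nat.split)
  then show ?thesis by (intro poly_eqI)
qed

lemma shear:
  fixes g :: "'a::idom poly poly"
  defines "g' \<equiv> S (x_part g) (y_part g)"
  shows "shear g \<in> Iso g g'" and "coords g' (shear g) = shear_coords g"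
proof -
  let ?h = "xy_part g"
  have "g = g' + [:[:0, 1:]:] * [:0, 1:] * ?h"
    using xy_decomposition[of g] by (simp add: g'_def S_def x_part_def)
  then have "[:g:] = [:g' + [:[:0, 1:]:] * [:0, 1:] * ?h:]"
    by (rule arg_cong)
  also have "\<dots> = [:g':] + X3 * Y3 * [:?h:]"
    by (simp add: X3_def Y3_def)
  finally have g: "[:g:] = [:g':] + X3 * Y3 * [:?h:]" .
  \<comment> \<open>The term x y h moves from \<open>g\<close> to the z-side, so the equations
    correspond exactly; z + h gives the inverse.\<close>
  have "subst3 C3 X3 Y3 (Z3 - [:?h:]) (srf g') = srf g"
    by (simp add: srf_def subst.hom_simps subst3_const g algebra_simps)
  then have 1: "srf g dvd subst3 C3 X3 Y3 (Z3 - [:?h:]) (srf g')"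
    by simp
  have "subst3 C3 X3 Y3 (Z3 + [:?h:]) (srf g) = srf g'"
    unfolding srf_def subst.hom_simps subst3_const C3.subst3_simps by (simp add: g algebra_simps)
  then have 2: "srf g' dvd subst3 C3 X3 Y3 (Z3 + [:?h:]) (srf g)"
    by simp
  note M = mor_of_coords[OF 1, folded shear_coords_def g'_def]
  have sh: "shear g \<in> Mor g g'" "coords g' (shear g) = shear_coords g"
    using M by (simp_all add: shear_def g'_def)
  obtain \<psi> where \<psi>: "\<psi> \<in> Mor g' g" "coords g \<psi> = (fn g' X3, fn g' Y3, fn g' (Z3 + [:?h:]))"
    using Mor_exists[OF 2] by blast
  have "shear g (\<psi> (fn g V)) = fn g V" "\<psi> (shear g (fn g' V)) = fn g' V" if "V \<in> {X3, Y3, Z3}" for V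
    using that unfolding Mor_subst[OF \<psi>] Mor_subst[OF sh(1) sh(2)[unfolded shear_coords_def]]
    by (auto simp: subst.hom_simps subst3_const)
  then show "shear g \<in> Iso g g'"
    by (intro IsoI[OF sh(1) \<psi>(1)])
  show "coords g' (shear g) = shear_coords g" by fact
qed

subsection \<open>Laurent series points\<close>

lemma type_hom_fls_const: "type_hom (fls_const :: 'a::idom \<Rightarrow> 'a fls)"
  by unfold_locales (simp_all add: fls_plus_const)

abbreviation fls_poly :: "'a::idom poly \<Rightarrow> 'a fls \<Rightarrow> 'a fls"
  where "fls_poly p \<equiv> poly (map_poly fls_const p)"

text \<open>A Laurent series point as an R-algebra homomorphism; \<open>e \<circ> \<phi>\<close> is
  its image under the morphism with pullback \<open>\<phi>\<close>.\<close>

definition is_point :: "'a::idom poly poly \<Rightarrow> ('a poly3 set \<Rightarrow> 'a fls) \<Rightarrow> bool"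
  where "is_point g e \<longleftrightarrow>
    e \<in> ring_hom (coord_ring g) ring_of_type \<and> (\<forall>r. e (fn g (C3 r)) = fls_const r)"

lemma is_point_type_hom:
  assumes "is_point g e"
  shows "type_hom (\<lambda>P. e (fn g P))"
proof -
  have e: "e \<in> ring_hom (coord_ring g) ring_of_type"
    using assms by (simp add: is_point_def)
  show ?thesis
    using ring_hom_add[OF e fn_closed fn_closed] ring_hom_mult[OF e fn_closed fn_closed] ring_hom_one[OF e]
    by unfold_locales (simp_all add: fn_simps)
qed

lemma is_point_Mor: "is_point g e \<Longrightarrow> \<phi> \<in> Mor g g' \<Longrightarrow> is_point g' (e \<circ> \<phi>)"
  unfolding is_point_def by (auto simp: Mor_C3 intro: ring_hom_trans[OF Mor_ring_hom])

lemma is_point_eval3: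
  assumes "is_point g e"
  shows "e (fn g (eval3 p P)) = fls_poly p (e (fn g P))"
  using assms by (intro hom_eval3[OF is_point_type_hom[OF assms] type_hom_fls_const])
    (simp add: is_point_def)

lemma is_point_exists:
  assumes "subst3 fls_const x y z (srf g) = 0"
  obtains e where "is_point g e" "\<And>P. e (fn g P) = subst3 fls_const x y z P"
proof -
  interpret k: type_hom "fls_const :: 'a \<Rightarrow> 'a fls"
    by (rule type_hom_fls_const)
  interpret f: type_hom "subst3 fls_const x y z"
    by (rule k.type_hom_subst3)
  have "subst3 fls_const x y z P = subst3 fls_const x y z Q" if "srf g dvd P - Q" for P Q
    using f.hom_dvd[OF that] assms by (simp add: f.hom_diff)
  from fn_liftE[of g "subst3 fls_const x y z", OF this]
  obtain e where e: "\<And>P. e (fn g P) = subst3 fls_const x y z P"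
    by blast
  have "e \<in> ring_hom (coord_ring g) ring_of_type"
    by (rule ring_hom_memI) (auto simp: carrier_coord_ring fn_simps e f.hom_simps)
  then have "is_point g e"
    by (simp add: is_point_def e)
  then show ?thesis using e that by blast
qed

section \<open>Pole orders and their growth\<close>

lemma fls_poly_pole:
  assumes "fls_subdegree u < 0" "p \<noteq> 0"
  shows "fls_poly p u \<noteq> 0 \<and> fls_subdegree (fls_poly p u) = int (degree p) * fls_subdegree u"
  using assms(2)
proof (induction p)
  case (pCons c p)
  have u: "u \<noteq> 0" using assms(1) by auto
  have eq: "fls_poly (pCons c p) u = fls_const c + u * fls_poly p u"
    by (simp add: map_poly_pCons)
  show ?case
  proof (cases "p = 0")
    case True
    then show ?thesis using pCons.hyps by (simp add: map_poly_pCons)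
  next
    case False
    let ?v = "u * fls_poly p u"
    have v: "?v \<noteq> 0" "fls_subdegree ?v = int (Suc (degree p)) * fls_subdegree u"
      using pCons.IH[OF False] u by (simp_all add: algebra_simps)
    moreover from v(2) assms(1) have "fls_subdegree ?v < 0"
      by (simp add: mult_pos_neg)
    \<comment> \<open>The constant has subdegree 0, so in Horner form the pole of \<open>?v\<close>
      absorbs it.\<close>
    ultimately have "fls_subdegree (fls_const c + ?v) = int (Suc (degree p)) * fls_subdegree u"
      "fls_subdegree (fls_const c + ?v) < 0"
      by (simp_all add: fls_subdegree_add_eq2)
    then show ?thesis
      unfolding eq using False by auto
  qed
qed simp

text \<open>The growth invariant: \<open>v\<close> has a genuine pole, of order at least that of
  \<open>u\<close>, and \<open>u\<close> is nonzero so that subdegrees add in products with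
  it.\<close>

definition dominates :: "'a::idom fls \<Rightarrow> 'a fls \<Rightarrow> bool"
  where "dominates v u \<longleftrightarrow> u \<noteq> 0 \<and> fls_subdegree v < 0 \<and> fls_subdegree v \<le> fls_subdegree u"

text \<open>The subdegree of \<open>w\<close> is \<open>degree q\<close> times that of
  \<open>v\<close> minus that of \<open>u\<close>, hence at most twice the negative subdegree of
  \<open>v\<close>.\<close>

lemma dominates_step:
  assumes "dominates v u" "degree q \<ge> 3" "u * w = fls_poly q v"
  shows "dominates w v" "fls_subdegree w < fls_subdegree v"
proof -
  have v: "fls_subdegree v < 0" "fls_subdegree v \<le> fls_subdegree u" and u: "u \<noteq> 0"
    using assms(1) by (auto simp: dominates_def)
  have "q \<noteq> 0" using assms(2) by auto
  from fls_poly_pole[OF v(1) this]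
  have nz: "u * w \<noteq> 0" and uw: "fls_subdegree (u * w) = int (degree q) * fls_subdegree v"
    using assms(3) by simp_all
  then have sub: "fls_subdegree u + fls_subdegree w = int (degree q) * fls_subdegree v"
    by simp
  have "int (degree q) * fls_subdegree v \<le> 3 * fls_subdegree v"
    using assms(2) v(1) by (intro mult_right_mono_neg) auto
  then show "fls_subdegree w < fls_subdegree v"
    using sub v by linarith
  then show "dominates w v"
    using v by (auto simp: dominates_def)
qed

context
  fixes p q :: "'a::idom poly" and e
  assumes adm: "admissible p q" and e: "is_point (S p q) e"
begin

lemma is_point_sigma_y: "is_point (S (bar p) q) (e \<circ> sigma_y p q)"
  using is_point_Mor[OF e Iso_Mor[OF sigma_y_Iso[OF adm]]] .

lemma is_point_sigma_x: "is_point (S p (bar q)) (e \<circ> sigma_x p q)"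
  using is_point_Mor[OF e Iso_Mor[OF sigma_x_Iso[OF adm]]] .

lemma sigma_y_point:
  shows "e (sigma_y p q (fn (S (bar p) q) Y3)) = e (fn (S p q) Y3)"
    and "e (fn (S p q) X3) * e (sigma_y p q (fn (S (bar p) q) X3)) = fls_poly q (e (fn (S p q) Y3))"
proof -
  interpret type_hom "\<lambda>P. e (fn (S p q) P)" using e by (rule is_point_type_hom)
  obtain U where U: "sigma_y_coords p q = (fn (S p q) (xbar_y p), fn (S p q) Y3, fn (S p q) U)"
    "coords (S (bar p) q) (sigma_y p q) = sigma_y_coords p q"
    using sigma_y_exists[OF adm] by metis
  \<comment> \<open>The relation x times new x equals b(y) is the surface equation itself.\<close>
  have "X3 * xbar_y p - eval3 q Y3 = srf (S p q)"
    unfolding srf_S xbar_y_def eval3_star[of p X3] by (simp add: algebra_simps)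
  then have "fn (S p q) (X3 * xbar_y p) = fn (S p q) (eval3 q Y3)"
    by (simp add: fn_eq_iff)
  then show "e (sigma_y p q (fn (S (bar p) q) Y3)) = e (fn (S p q) Y3)"
    "e (fn (S p q) X3) * e (sigma_y p q (fn (S (bar p) q) X3)) = fls_poly q (e (fn (S p q) Y3))"
    using U by (simp_all add: coords_def is_point_eval3[OF e, symmetric] hom_mult[symmetric])
qed

lemma sigma_x_point:
  shows "e (sigma_x p q (fn (S p (bar q)) X3)) = e (fn (S p q) X3)"
    and "e (fn (S p q) Y3) * e (sigma_x p q (fn (S p (bar q)) Y3)) = fls_poly p (e (fn (S p q) X3))"
proof -
  interpret type_hom "\<lambda>P. e (fn (S p q) P)" using e by (rule is_point_type_hom)
  obtain U where U: "sigma_x_coords p q = (fn (S p q) X3, fn (S p q) (ybar_x q), fn (S p q) U)"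
    "coords (S p (bar q)) (sigma_x p q) = sigma_x_coords p q"
    using sigma_x_exists[OF adm] by metis
  have "coeff p 0 = coeff q 0" using adm by (simp add: admissible_iff)
  then have "Y3 * ybar_x q - eval3 p X3 = srf (S p q)"
    unfolding srf_S ybar_x_def eval3_star[of q Y3] by (simp add: algebra_simps)
  then have "fn (S p q) (Y3 * ybar_x q) = fn (S p q) (eval3 p X3)"
    by (simp add: fn_eq_iff)
  then show "e (sigma_x p q (fn (S p (bar q)) X3)) = e (fn (S p q) X3)"
    "e (fn (S p q) Y3) * e (sigma_x p q (fn (S p (bar q)) Y3)) = fls_poly p (e (fn (S p q) X3))"
    using U by (simp_all add: coords_def is_point_eval3[OF e, symmetric] hom_mult[symmetric])
qed

text \<open>The roles of the coordinates are exchanged, which is just what a following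
  \<open>sigma_x\<close> requires.\<close>

lemma sigma_y_dominates:
  assumes "dominates (e (fn (S p q) Y3)) (e (fn (S p q) X3))"
  defines "e' \<equiv> e \<circ> sigma_y p q"
  shows "dominates (e' (fn (S (bar p) q) X3)) (e' (fn (S (bar p) q) Y3))"
    and "fls_subdegree (e' (fn (S (bar p) q) X3)) < fls_subdegree (e (fn (S p q) Y3))"
  using dominates_step[OF assms(1) _ sigma_y_point(2)] adm
  by (simp_all add: e'_def sigma_y_point(1) admissible_def)

lemma sigma_x_dominates:
  assumes "dominates (e (fn (S p q) X3)) (e (fn (S p q) Y3))"
  defines "e' \<equiv> e \<circ> sigma_x p q"
  shows "dominates (e' (fn (S p (bar q)) Y3)) (e' (fn (S p (bar q)) X3))"
    and "fls_subdegree (e' (fn (S p (bar q)) Y3)) < fls_subdegree (e (fn (S p q) X3))"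
  using dominates_step[OF assms(1) _ sigma_x_point(2)] adm
  by (simp_all add: e'_def sigma_x_point(1) admissible_def)

end

section \<open>The cycle of four maps and the growth along its iterates\<close>

context
  fixes a b :: "'a::idom poly"
  assumes adm: "admissible a b"
begin

lemma sigma_cycle_Iso:
  shows "sigma_y a b \<in> Iso (S a b) (S (bar a) b)"
    and "sigma_x (bar a) b \<in> Iso (S (bar a) b) (S (bar a) (bar b))"
    and "sigma_y (bar a) (bar b) \<in> Iso (S (bar a) (bar b)) (S a (bar b))"
    and "sigma_x a (bar b) \<in> Iso (S a (bar b)) (S a b)"
  using sigma_y_Iso[OF adm] sigma_x_Iso[OF admissible_bar(1)[OF adm]]
    sigma_y_Iso[OF admissible_bar(2)[OF admissible_bar(1)[OF adm]]]
    sigma_x_Iso[OF admissible_bar(2)[OF adm]]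
  by (simp_all add: bar_bar[OF adm])

lemma sigma_ab_Iso: "sigma_ab a b \<in> Iso (S a b) (S a b)"
  unfolding sigma_ab_def
  by (rule Iso_comp[OF Iso_comp[OF Iso_comp]]) (rule sigma_cycle_Iso)+

lemma sigma_ab_dominates:
  assumes e: "is_point (S a b) e" and dom: "dominates (e (fn (S a b) Y3)) (e (fn (S a b) X3))"
  defines "e' \<equiv> e \<circ> sigma_ab a b"
  shows "is_point (S a b) e'" "dominates (e' (fn (S a b) Y3)) (e' (fn (S a b) X3))"
    "fls_subdegree (e' (fn (S a b) Y3)) < fls_subdegree (e (fn (S a b) Y3))"
proof -
  note bb = bar_bar[OF adm]
  note adm1 = admissible_bar(1)[OF adm]
  note adm2 = admissible_bar(2)[OF adm1]
  note adm3 = admissible_bar(2)[OF adm]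
  \<comment> \<open>These are the successive images of the point; the pole of the dominating
    coordinate grows at each of the four steps.\<close>
  define e1 where "e1 = e \<circ> sigma_y a b"
  define e2 where "e2 = e1 \<circ> sigma_x (bar a) b"
  define e3 where "e3 = e2 \<circ> sigma_y (bar a) (bar b)"
  define e4 where "e4 = e3 \<circ> sigma_x a (bar b)"
  note pt1 = is_point_sigma_y[OF adm e, folded e1_def]
  note pt2 = is_point_sigma_x[OF adm1 pt1, folded e2_def]
  note pt3 = is_point_sigma_y[OF adm2 pt2, folded e3_def, unfolded bb]
  note dom1 = sigma_y_dominates[OF adm e dom, folded e1_def]
  note dom2 = sigma_x_dominates[OF adm1 pt1 dom1(1), folded e2_def]
  note dom3 = sigma_y_dominates[OF adm2 pt2 dom2(1), folded e3_def, unfolded bb]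
  note dom4 = sigma_x_dominates[OF adm3 pt3 dom3(1), folded e4_def, unfolded bb]
  have "e' (fn (S a b) P) = e4 (fn (S a b) P)" for P
  proof -
    \<comment> \<open>\<open>mor_comp_apply\<close> needs arguments of the form
      \<open>fn g P\<close>, so the intermediate functions receive representatives.\<close>
    note M = sigma_cycle_Iso[THEN Iso_Mor]
    obtain Q where Q: "sigma_x a (bar b) (fn (S a b) P) = fn (S a (bar b)) Q"
      using Mor_fnE[OF M(4)] .
    obtain Q' where Q': "sigma_y (bar a) (bar b) (fn (S a (bar b)) Q) = fn (S (bar a) (bar b)) Q'"
      using Mor_fnE[OF M(3)] .
    show ?thesis
      by (simp add: e'_def e4_def e3_def e2_def e1_def sigma_ab_def mor_comp_apply Q Q')
  qed
  then show "dominates (e' (fn (S a b) Y3)) (e' (fn (S a b) X3))"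
    "fls_subdegree (e' (fn (S a b) Y3)) < fls_subdegree (e (fn (S a b) Y3))"
    using dom1(2) dom2(2) dom3(2) dom4 by simp_all
  show "is_point (S a b) e'"
    unfolding e'_def by (rule is_point_Mor[OF e Iso_Mor[OF sigma_ab_Iso]])
qed

text \<open>The induction replaces the point \<open>e\<close> by its image
  \<open>e \<circ> sigma_ab a b\<close>, so the outermost application is absorbed into the
  point.\<close>

lemma sigma_ab_funpow_subdegree:
  assumes "is_point (S a b) e" "dominates (e (fn (S a b) Y3)) (e (fn (S a b) X3))"
  shows "fls_subdegree (e ((sigma_ab a b ^^ k) (fn (S a b) Y3)))
    \<le> fls_subdegree (e (fn (S a b) Y3)) - int k"
  using assms
proof (induction k arbitrary: e)
  case (Suc k)
  note step = sigma_ab_dominates[OF Suc.prems]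
  show ?case
    using Suc.IH[OF step(1,2)] step(3) by simp
qed simp

lemma sigma_ab_funpow_neq:
  assumes "k > 0"
  shows "(sigma_ab a b ^^ k) (fn (S a b) Y3) \<noteq> fn (S a b) Y3"
proof -
  interpret k: type_hom "fls_const :: 'a \<Rightarrow> 'a fls"
    by (rule type_hom_fls_const)
  \<comment> \<open>This is the right side of the equation at x = 1 and y = 1/t; solving for z gives
    \<open>fls_X * ?r\<close>.\<close>
  let ?r = "fls_poly a 1 + fls_poly b fls_X_inv - fls_const (coeff a 0)"
  interpret f: type_hom "subst3 fls_const 1 fls_X_inv (fls_X * ?r)"
    by (rule k.type_hom_subst3)
  have "fls_X_inv * (fls_X * ?r) = ?r"
    by (simp add: fls_X_inv_times_conv_shift fls_X_times_conv_shift)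
  then have "subst3 fls_const 1 fls_X_inv (fls_X * ?r) (srf (S a b)) = 0"
    by (simp add: srf_S f.hom_simps hom_eval3[OF f.type_hom_axioms k.type_hom_axioms])
  from is_point_exists[OF this] obtain e where e: "is_point (S a b) e"
    "\<And>P. e (fn (S a b) P) = subst3 fls_const 1 fls_X_inv (fls_X * ?r) P"
    by blast
  \<comment> \<open>Here y = 1/t has subdegree -1 and x = 1 has subdegree 0.\<close>
  have "dominates (e (fn (S a b) Y3)) (e (fn (S a b) X3))"
    by (simp add: e(2) dominates_def)
  from sigma_ab_funpow_subdegree[OF e(1) this, of k] show ?thesis
    using assms by auto
qed

end

text \<open>Units are nonzero, so the pure powers of x and y attain the bidegree of
  \<open>g\<close>, and its axis restrictions keep these degrees.\<close>

lemma admissible_parts: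
  fixes g :: "'a::idom poly poly"
  assumes "degree_x g \<ge> 3" "degree g \<ge> 3" "coeff (coeff g 0) (degree_x g) dvd 1"
    and "coeff (lead_coeff g) 0 dvd 1" "coeff (coeff g 0) 0 dvd 1"
  shows "admissible (x_part g) (y_part g)"
proof -
  have a: "x_part g = coeff g 0"
    by (simp add: x_part_def poly_0_coeff_0)
  have b: "coeff (y_part g) j = coeff (coeff g j) 0" for j
    by (simp add: y_part_def coeff_map_poly poly_0_coeff_0)
  have "degree (coeff g 0) \<le> degree_x g"
    unfolding degree_x_def by (rule Max_ge) auto
  moreover have "degree_x g \<le> degree (coeff g 0)"
    using assms(3) by (intro le_degree) auto
  ultimately have da: "degree (coeff g 0) = degree_x g" by simp
  have "degree (y_part g) \<le> degree g"
    by (rule degree_le) (simp add: b coeff_eq_0)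
  moreover have "degree g \<le> degree (y_part g)"
    using assms(4) by (intro le_degree) (auto simp: b)
  ultimately have db: "degree (y_part g) = degree g" by simp
  show ?thesis
    using assms by (simp add: admissible_def a b da db poly_0_coeff_0)
qed

theorem theorem3:
  fixes g :: "'a::idom poly poly" and n m :: nat and a b :: "'a poly" and c :: 'a
    and h :: "'a poly poly"
  assumes "degree_x g = n" and "degree g = m" and "n \<ge> 3" and "m \<ge> 3"
    and "coeff (coeff g 0) n dvd 1"
    and "coeff (coeff g m) 0 dvd 1"
    and "coeff (coeff g 0) 0 dvd 1"
    and "a = x_part g" and "b = y_part g" and "c = poly (poly g 0) 0" and "h = xy_part g"
  shows
    "(\<forall>p q :: 'a poly. admissible p q \<longrightarrow>
        admissible (bar p) q \<and> admissible p (bar q) \<and> bar (bar p) = p \<and> bar (bar q) = q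
      \<and> (\<exists>!w. is_quotient (S p q) (znum_y p) Y3 w)
      \<and> sigma_y p q \<in> Iso (S p q) (S (bar p) q)
      \<and> coords (S (bar p) q) (sigma_y p q) = sigma_y_coords p q
      \<and> (\<exists>!w. is_quotient (S p q) (znum_x q) X3 w)
      \<and> sigma_x p q \<in> Iso (S p q) (S p (bar q))
      \<and> coords (S p (bar q)) (sigma_x p q) = sigma_x_coords p q)
    \<and> g = [:a:] + map_poly (\<lambda>r. [:r:]) b - [:[:c:]:] + [:[:0, 1:]:] * [:0, 1:] * h
    \<and> admissible a b
    \<and> shear g \<in> Iso g (S a b)
    \<and> coords (S a b) (shear g) = (fn g X3, fn g Y3, fn g (Z3 - [:h:]))
    \<and> sigma_y a b \<in> Iso (S a b) (S (bar a) b)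
    \<and> sigma_x (bar a) b \<in> Iso (S (bar a) b) (S (bar a) (bar b))
    \<and> sigma_y (bar a) (bar b) \<in> Iso (S (bar a) (bar b)) (S a (bar b))
    \<and> sigma_x a (bar b) \<in> Iso (S a (bar b)) (S a b)
    \<and> sigma_ab a b \<in> carrier (Aut (S a b))
    \<and> infinite_order (Aut (S a b)) (sigma_ab a b)
    \<and> sigma g \<in> carrier (Aut g)
    \<and> infinite_order (Aut g) (sigma g)"
proof -
  have adm: "admissible a b"
    unfolding assms(8,9) using assms(1-7) by (intro admissible_parts) simp_all
  have shear: "shear g \<in> Iso g (S a b)"
    "coords (S a b) (shear g) = (fn g X3, fn g Y3, fn g (Z3 - [:h:]))"
    using shear[of g] by (simp_all add: assms(8,9,11) shear_coords_def)
  have sigma: "sigma g = mor_comp g (mor_inv g (S a b) (shear g)) (mor_comp (S a b) (sigma_ab a b) (shear g))"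
    by (simp add: sigma_def Let_def assms(8,9))
  have "sigma g \<in> Iso g g"
    unfolding sigma
    by (rule Iso_comp[OF Iso_comp[OF shear(1) sigma_ab_Iso[OF adm]] mor_inv_Iso[OF shear(1)]])
  moreover have "infinite_order (Aut g) (sigma g)"
    unfolding sigma
    by (rule infinite_order_conjugate[OF shear(1) Iso_Mor[OF sigma_ab_Iso[OF adm]]])
      (rule sigma_ab_funpow_neq[OF adm])
  moreover have "infinite_order (Aut (S a b)) (sigma_ab a b)"
    using sigma_ab_funpow_neq[OF adm] by (rule infinite_orderI)
  moreover have "g = [:a:] + map_poly (\<lambda>r. [:r:]) b - [:[:c:]:] + [:[:0, 1:]:] * [:0, 1:] * h"
    unfolding assms(8-11) by (rule xy_decomposition)
  moreover have "admissible (bar p) q \<and> admissible p (bar q) \<and> bar (bar p) = p \<and> bar (bar q) = q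
      \<and> (\<exists>!w. is_quotient (S p q) (znum_y p) Y3 w)
      \<and> sigma_y p q \<in> Iso (S p q) (S (bar p) q)
      \<and> coords (S (bar p) q) (sigma_y p q) = sigma_y_coords p q
      \<and> (\<exists>!w. is_quotient (S p q) (znum_x q) X3 w)
      \<and> sigma_x p q \<in> Iso (S p q) (S p (bar q))
      \<and> coords (S p (bar q)) (sigma_x p q) = sigma_x_coords p q" if "admissible p q" for p q :: "'a poly"
  proof -
    have "\<exists>!w. is_quotient (S p q) (znum_y p) Y3 w"
      "coords (S (bar p) q) (sigma_y p q) = sigma_y_coords p q"
      by (rule sigma_y_exists[OF that], assumption)+
    moreover have "\<exists>!w. is_quotient (S p q) (znum_x q) X3 w"
      "coords (S p (bar q)) (sigma_x p q) = sigma_x_coords p q"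
      by (rule sigma_x_exists[OF that], assumption)+
    ultimately show ?thesis
      using admissible_bar[OF that] bar_bar[OF that] sigma_y_Iso[OF that] sigma_x_Iso[OF that]
      by simp
  qed
  ultimately show ?thesis
    using adm shear sigma_cycle_Iso[OF adm] sigma_ab_Iso[OF adm] by (simp add: Aut_def)
qed

end
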